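(* Let $B$ be an infinite Blaschke product with uniformly separated zeros $\{a_n\}$. If $-1 < \alpha \le 0$ and $1 + \frac{1}{2}\alpha < p < \min\{1, \frac{4}{3} + \frac{2}{3}\alpha\}$, and if \[ \sum_n (1 - |a_n|)^{\frac{4 - 3p + 2\alpha}{2 - p}} < \infty, \] then $f' \in A^p_{\alpha}$ for all $f \in (BH^2)^{\perp}$.
   Context: $U$ denotes the open unit disc in $\mathbb{C}$. For $0<p<\infty$ and $\alpha>-1$, $A_\alpha^p$ is the set of all functions $f$ analytic in $U$ with $\|f\|_{A_\alpha^p} = \left\{\frac{1}{\pi}\iint_U |f(z)|^p (1-|z|)^\alpha\, dA(z)\right\}^{1/p} < \infty$, where $dA$ is Lebesgue area measure. If $\{a_n\}_{n\ge 1}$ is a sequence of complex numbers with $0<|a_n|<1$ for all $n$ and $\sum_n (1-|a_n|)<\infty$, the Blaschke product with zeros $\{a_n\}$ is the analytic function on $U$ given by $B(z) = \prod_{n=1}^\infty \frac{\bar a_n}{|a_n|}\frac{a_n - z}{1-\bar a_n z}$. A sequence $\{a_n\}$ in $U$ is uniformly separated if there is a constant $\delta>0$ such that $\inf_n\prod_{m\ne n}\rho(a_m,a_n)\ge\delta$, where $\rho(z,w) = \left|\frac{z-w}{1-\bar w z}\right|$ is the pseudohyperbolic metric on $U$. $H^2$ is the Hardy space of analytic functions $f$ on $U$ with $\sup_{0<r<1}\left\{\frac{1}{2\pi}\int_0^{2\pi}|f(re^{it})|^2\,dt\right\}^{1/2}<\infty$, with its usual Hilbert space structure. $(BH^2)^\perp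 = H^2\ominus BH^2$ is the orthogonal complement in $H^2$ of the subspace $BH^2$ (the model space for $B$). *)

theory Defs
  imports "HOL-Complex_Analysis.Complex_Analysis"
begin

abbreviation unit_disc :: "complex set" where
  "unit_disc \<equiv> ball 0 1"

(* Functions on the disc are total functions on the complex plane throughout; all notions
   below depend only on their values on the disc.
   The factor 1/pi and the p-th root in the norm do not affect its finiteness. *)
definition bergman_space :: "real \<Rightarrow> real \<Rightarrow> (complex \<Rightarrow> complex) set" where
  "bergman_space p \<alpha> = {f. f holomorphic_on unit_disc \<and>
     (\<integral>\<^sup>+z\<in>unit_disc. ennreal (norm (f z) powr p * (1 - norm z) powr \<alpha>) \<partial>lborel) < \<infinity>}"

definition blaschke_sequence :: "(nat \<Rightarrow> complex) \<Rightarrow> bool" where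
  "blaschke_sequence a \<longleftrightarrow>
     (\<forall>n. 0 < norm (a n) \<and> norm (a n) < 1) \<and> summable (\<lambda>n. 1 - norm (a n))"

definition blaschke_product :: "(nat \<Rightarrow> complex) \<Rightarrow> complex \<Rightarrow> complex" where
  "blaschke_product a z =
     (\<Prod>n. cnj (a n) / of_real (norm (a n)) * ((a n - z) / (1 - cnj (a n) * z)))"

definition pseudohyperbolic :: "complex \<Rightarrow> complex \<Rightarrow> real" where
  "pseudohyperbolic z w = norm ((z - w) / (1 - cnj w * z))"

(* The partial products decrease, so they always have a limit. If that limit is positive, it is
   the value in the sense of has_prod. If the limit is 0, has_prod admits at most the
   value 0 (and no value at all when no factor vanishes), so the condition fails, as it should.
   prodinf would be unspecified in the latter case. *)
definition uniformly_separated :: "(nat \<Rightarrow> complex) \<Rightarrow> bool" where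
  "uniformly_separated a \<longleftrightarrow> range a \<subseteq> unit_disc \<and>
     (\<exists>\<delta>>0. \<forall>n. \<exists>P\<ge>\<delta>. (\<lambda>m. if m = n then 1 else pseudohyperbolic (a m) (a n)) has_prod P)"

definition hardy2 :: "(complex \<Rightarrow> complex) set" where
  "hardy2 = {f. f holomorphic_on unit_disc \<and>
     bdd_above ((\<lambda>r. sqrt (1 / (2 * pi) * integral {0..2 * pi} (\<lambda>t. (norm (f (rcis r t)))\<^sup>2)))
                ` {0<..<1})}"

(* The integral means of f in H^2 increase with r, so that the supremum defining the norm is
   their limit as r tends to 1; polarizing gives this inner product. It equals the
   inner product in L^2 of the circle of the radial boundary functions. *)
definition hardy2_inner :: "(complex \<Rightarrow> complex) \<Rightarrow> (complex \<Rightarrow> complex) \<Rightarrow> complex" where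
  "hardy2_inner f g =
     Lim (at_left 1) (\<lambda>r. of_real (1 / (2 * pi)) *
       integral {0..2 * pi} (\<lambda>t. f (rcis r t) * cnj (g (rcis r t))))"

definition hardy2_orth :: "(complex \<Rightarrow> complex) set \<Rightarrow> (complex \<Rightarrow> complex) set" where
  "hardy2_orth S = {f \<in> hardy2. \<forall>g\<in>S. hardy2_inner f g = 0}"

definition model_space :: "(complex \<Rightarrow> complex) \<Rightarrow> (complex \<Rightarrow> complex) set" where
  "model_space B = hardy2_orth ((\<lambda>g z. B z * g z) ` hardy2)"

end

theory Submission
  imports Defs
begin

text \<open>
  Let \<open>k\<^sub>n(z) = 1 / (1 - cnj (a n) * z)\<close> be the Szego kernel at the \<open>n\<close>-th zero. For separated zeros
  the normalized kernels form a Riesz basis of the model space, so that \<open>f = \<Sum> \<gamma>\<^sub>n k\<^sub>n\<close> with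
  \<open>\<Sum> \<bar>\<gamma>\<^sub>n\<bar>\<^sup>2 / (1 - \<bar>a\<^sub>n\<bar>\<^sup>2) < \<infinity>\<close>. Differentiating, using subadditivity of the \<open>p\<close>-th power for \<open>p \<le> 1\<close> and the
  area estimate \<open>\<integral> (1 - \<bar>z\<bar>)\<^sup>\<alpha> / \<bar>1 - cnj a * z\<bar>\<^sup>2\<^sup>p dA \<le> C (1 - \<bar>a\<bar>) powr (2 + \<alpha> - 2 p)\<close>, which needs
  \<open>2 p > 2 + \<alpha>\<close>, bounds the Bergman integral of \<open>f'\<close> by
  \<open>\<Sum> \<bar>\<gamma>\<^sub>n\<bar>\<^sup>p (1 - \<bar>a\<^sub>n\<bar>) powr (2 + \<alpha> - 2 p)\<close>. Young's inequality splits this into the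
  square sum of the normalized coefficients and the sum that is assumed to converge.

  The argument is carried out with finitely many kernels at a time, since Fatou's lemma passes from
  uniform bounds for approximants to the limit. The approximants \<open>f\<^sub>N\<close> are the projections of \<open>f\<close> to the span of the
  first \<open>N\<close> kernels. Lemma \<open>model_space_approximation\<close> shows \<open>f\<^sub>N \<rightarrow> f\<close> locally uniformly; this is the place
  where orthogonality of \<open>f\<close> to \<open>B H\<^sup>2\<close> enters. Lemma \<open>kernel_coefficients_le\<close> bounds the coefficients of \<open>f\<^sub>N\<close>
  independently of \<open>N\<close>. It is dual to interpolation in \<open>H\<^sup>2\<close> with uniform bounds, which Jones's explicit functions
  provide in lemma \<open>hardy_interpolation\<close>; the area estimate is lemma
  \<open>area_integral_szego_power\<close>.

  The Hardy space is handled through square-summable Taylor coefficients, and all estimates of norms are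
  made on circles of radius less than one.
\<close>

section \<open>Taylor coefficients and means over circles\<close>

definition tcoeff :: "(complex \<Rightarrow> complex) \<Rightarrow> nat \<Rightarrow> complex" where
  "tcoeff f n = (deriv ^^ n) f 0 / fact n"

lemma tcoeff_sums:
  assumes "f holomorphic_on unit_disc" "norm z < 1"
  shows "(\<lambda>n. tcoeff f n * z ^ n) sums f z"
  using holomorphic_power_series[OF assms(1), of z] assms(2) by (simp add: tcoeff_def)

text \<open>Any power series expansion in the disc identifies the coefficients; linearity of the coefficients
  and the coefficients of the Szego kernel are obtained in this way.\<close>
lemma tcoeff_unique:
  assumes "\<And>z. norm z < 1 \<Longrightarrow> (\<lambda>n. c n * z ^ n) sums f z"
  shows "tcoeff f n = c n"
proof -
  have "eventually (\<lambda>z. z \<in> ball (0::complex) 1) (nhds 0)"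
    by (rule eventually_nhds_in_open) auto
  then have ev: "eventually (\<lambda>z. (\<lambda>n. fps_nth (Abs_fps c) n * z ^ n) sums f z) (nhds 0)"
    by eventually_elim (use assms in auto)
  have "f has_fps_expansion Abs_fps c"
    by (rule has_fps_expansionI[OF ev])
  from fps_nth_fps_expansion[OF this, of n] show ?thesis by (simp add: tcoeff_def)
qed

lemma tcoeff_cong:
  assumes "f holomorphic_on unit_disc" "\<And>z. norm z < 1 \<Longrightarrow> f z = g z"
  shows "tcoeff f n = tcoeff g n"
  by (rule tcoeff_unique[symmetric]) (use tcoeff_sums[OF assms(1)] assms(2) in fastforce)

lemma tcoeff_add:
  assumes "f holomorphic_on unit_disc" "g holomorphic_on unit_disc"
  shows "tcoeff (\<lambda>z. f z + g z) n = tcoeff f n + tcoeff g n"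
  by (rule tcoeff_unique)
     (use sums_add[OF tcoeff_sums[OF assms(1)] tcoeff_sums[OF assms(2)]] in \<open>simp add: algebra_simps\<close>)

lemma tcoeff_cmult:
  assumes "f holomorphic_on unit_disc"
  shows "tcoeff (\<lambda>z. c * f z) n = c * tcoeff f n"
  by (rule tcoeff_unique)
     (use sums_mult[OF tcoeff_sums[OF assms(1)], of _ c] in \<open>simp add: algebra_simps\<close>)

lemma tcoeff_sum:
  assumes "\<And>i. i \<in> I \<Longrightarrow> f i holomorphic_on unit_disc"
  shows "tcoeff (\<lambda>z. \<Sum>i\<in>I. c i * f i z) n = (\<Sum>i\<in>I. c i * tcoeff (f i) n)"
proof (rule tcoeff_unique)
  fix z :: complex assume z: "norm z < 1"
  have "(\<lambda>n. \<Sum>i\<in>I. c i * (tcoeff (f i) n * z ^ n)) sums (\<Sum>i\<in>I. c i * f i z)"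
    by (intro sums_sum sums_mult tcoeff_sums assms z)
  then show "(\<lambda>n. (\<Sum>i\<in>I. c i * tcoeff (f i) n) * z ^ n) sums (\<Sum>i\<in>I. c i * f i z)"
    by (simp add: sum_distrib_right mult.assoc)
qed

lemma continuous_on_circle:
  assumes "f holomorphic_on unit_disc" "0 \<le> r" "r < 1"
  shows "continuous_on A (\<lambda>t. f (rcis r t))"
proof (rule continuous_on_compose2[OF holomorphic_on_imp_continuous_on[OF assms(1)]])
  show "continuous_on A (rcis r)" unfolding rcis_def cis_conv_exp by (intro continuous_intros)
  show "rcis r ` A \<subseteq> unit_disc" using assms by auto
qed

lemma tcoeff_abs_summable:
  assumes "f holomorphic_on unit_disc" "0 \<le> r" "r < 1"
  shows "summable (\<lambda>n. norm (tcoeff f n) * r ^ n)"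
proof -
  have "summable (\<lambda>n. tcoeff f n * of_real ((r+1)/2) ^ n)"
    by (rule sums_summable[OF tcoeff_sums[OF assms(1)]]) (use assms in \<open>simp only: norm_of_real, simp\<close>)
  from powser_insidea[OF this, of "of_real r"] have "summable (\<lambda>n. norm (tcoeff f n * of_real r ^ n))"
    using assms by (simp only: norm_of_real) simp
  then show ?thesis using assms by (simp add: norm_mult norm_power)
qed

text \<open>On a circle of radius \<open>r < 1\<close> the power series converges uniformly, so it may be integrated
  termwise against any continuous \<open>h\<close>. Taking a character for \<open>h\<close> gives Cauchy's coefficient
  formula, and taking a conjugated analytic function gives Parseval's identity.\<close>
lemma integral_power_series_circle:
  assumes f: "f holomorphic_on unit_disc" and r: "0 \<le> r" "r < 1"
    and h: "continuous_on {0..2*pi} h"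
  shows "(\<lambda>n. tcoeff f n * of_real r ^ n * integral {0..2*pi} (\<lambda>t. cis (of_nat n * t) * h t))
           sums integral {0..2*pi} (\<lambda>t. f (rcis r t) * h t)"
proof -
  let ?u = "\<lambda>n t. tcoeff f n * rcis r t ^ n * h t"
  obtain M where M: "\<And>t. t \<in> {0..2*pi} \<Longrightarrow> norm (h t) \<le> M"
    using compact_imp_bounded[OF compact_continuous_image[OF h]] unfolding bounded_iff by blast
  have "uniform_limit {0..2*pi} (\<lambda>N t. \<Sum>n<N. ?u n t) (\<lambda>t. suminf (\<lambda>n. ?u n t)) sequentially"
  proof (rule Weierstrass_m_test)
    show "summable (\<lambda>n. norm (tcoeff f n) * r ^ n * M)"
      by (intro summable_mult2 tcoeff_abs_summable f r)
    fix n t assume "t \<in> {0..2*pi}"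
    then show "norm (?u n t) \<le> norm (tcoeff f n) * r ^ n * M"
      using M[of t] r by (auto simp: norm_mult norm_power intro!: mult_left_mono)
  qed
  moreover have "suminf (\<lambda>n. ?u n t) = f (rcis r t) * h t" for t
    by (rule sums_unique[symmetric], rule sums_mult2, rule tcoeff_sums[OF f]) (use r in simp)
  ultimately have ul: "uniform_limit {0..2*pi} (\<lambda>N t. \<Sum>n<N. ?u n t) (\<lambda>t. f (rcis r t) * h t) sequentially"
    by simp
  have cis_eq: "rcis r t ^ n = of_real r ^ n * cis (of_nat n * t)" for n t
    unfolding DeMoivre2 by (simp add: rcis_def)
  have cu: "continuous_on {0..2*pi} (?u n)" for n
    unfolding rcis_def cis_conv_exp by (intro continuous_intros h)
  then have cont: "continuous_on {0..2*pi} (\<lambda>t. \<Sum>n<N. ?u n t)" for N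
    by (intro continuous_on_sum)
  obtain I J where IJ: "\<And>N. ((\<lambda>t. \<Sum>n<N. ?u n t) has_integral I N) {0..2*pi}"
    "((\<lambda>t. f (rcis r t) * h t) has_integral J) {0..2*pi}" "I \<longlonglongrightarrow> J"
    using uniform_limit_integral[OF ul cont sequentially_bot] by blast
  have "I N = (\<Sum>n<N. tcoeff f n * of_real r ^ n * integral {0..2*pi} (\<lambda>t. cis (of_nat n * t) * h t))" for N
  proof -
    have "I N = integral {0..2*pi} (\<lambda>t. \<Sum>n<N. ?u n t)"
      by (rule integral_unique[OF IJ(1), symmetric])
    also have "\<dots> = (\<Sum>n<N. integral {0..2*pi} (?u n))"
      by (intro integral_sum finite_lessThan integrable_continuous_interval cu)
    also have "\<dots> = (\<Sum>n<N. tcoeff f n * of_real r ^ n * integral {0..2*pi} (\<lambda>t. cis (of_nat n * t) * h t))"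
      by (simp add: cis_eq mult.assoc flip: integral_mult_right)
    finally show ?thesis .
  qed
  then have "I = (\<lambda>N. \<Sum>n<N. tcoeff f n * of_real r ^ n * integral {0..2*pi} (\<lambda>t. cis (of_nat n * t) * h t))" ..
  with IJ(3) show ?thesis unfolding sums_def integral_unique[OF IJ(2)] by (simp only:)
qed

lemma integral_cis_int:
  "integral {0..2*pi} (\<lambda>t. cis (of_int k * t)) = (if k = 0 then 2 * pi else 0)"
proof (cases "k = 0")
  case False
  have "((\<lambda>t. cis (of_int k * t)) has_integral
      cis (of_int k * (2*pi)) / (\<i> * of_int k) - cis (of_int k * 0) / (\<i> * of_int k)) {0..2*pi}"
  proof (rule fundamental_theorem_of_calculus)
    fix t assume "t \<in> {0..2*pi}"
    have "((\<lambda>z. exp (\<i> * of_int k * z) / (\<i> * of_int k)) has_field_derivative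
        exp (\<i> * of_int k * of_real t)) (at (of_real t))"
      by (rule derivative_eq_intros refl | use False in simp)+
    from has_vector_derivative_real_field[OF this]
    show "((\<lambda>t. cis (of_int k * t) / (\<i> * of_int k)) has_vector_derivative cis (of_int k * t)) (at t within {0..2*pi})"
      by (simp add: cis_conv_exp mult.assoc)
  qed simp
  moreover have "cis (of_int k * (2*pi)) = 1"
    using cis_multiple_2pi[of "of_int k"] by (simp add: mult_ac)
  ultimately show ?thesis using False by (simp add: integral_unique)
qed (simp add: scaleR_conv_of_real)

lemma tcoeff_integral:
  assumes f: "f holomorphic_on unit_disc" and r: "0 \<le> r" "r < 1"
  shows "integral {0..2*pi} (\<lambda>t. f (rcis r t) * cis (- (of_nat m * t))) = 2 * pi * of_real r ^ m * tcoeff f m"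
proof -
  have c: "continuous_on {0..2*pi} (\<lambda>t. cis (- (of_nat m * t)))"
    unfolding cis_conv_exp by (intro continuous_intros)
  have "integral {0..2*pi} (\<lambda>t. cis (of_nat n * t) * cis (- (of_nat m * t))) = (if n = m then 2 * pi else 0)" for n
    using integral_cis_int[of "int n - int m"] by (simp add: cis_mult algebra_simps)
  then have "(\<lambda>n. if n = m then tcoeff f n * of_real r ^ n * (2 * pi) else 0)
      sums integral {0..2*pi} (\<lambda>t. f (rcis r t) * cis (- (of_nat m * t)))"
    using integral_power_series_circle[OF f r c] by (simp only: if_distrib[of "\<lambda>x. _ * of_real x"] of_real_0 mult_zero_right)
  from sums_unique2[OF this sums_single[of m "\<lambda>n. tcoeff f n * of_real r ^ n * (2 * pi)"]]
  show ?thesis by simp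
qed

lemma Parseval_circle:
  assumes f: "f holomorphic_on unit_disc" and g: "g holomorphic_on unit_disc" and r: "0 \<le> r" "r < 1"
  shows "(\<lambda>n. tcoeff f n * cnj (tcoeff g n) * of_real (r ^ (2*n))) sums
           (of_real (1/(2*pi)) * integral {0..2*pi} (\<lambda>t. f (rcis r t) * cnj (g (rcis r t))))"
proof -
  have c: "continuous_on {0..2*pi} (\<lambda>t. cnj (g (rcis r t)))"
    by (intro continuous_intros continuous_on_circle g r)
  have "integral {0..2*pi} (\<lambda>t. cis (of_nat n * t) * cnj (g (rcis r t))) = 2 * pi * of_real r ^ n * cnj (tcoeff g n)" for n
  proof -
    have "integral {0..2*pi} (\<lambda>t. cis (of_nat n * t) * cnj (g (rcis r t)))
        = integral {0..2*pi} (\<lambda>t. cnj (g (rcis r t) * cis (- (of_nat n * t))))"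
      by (simp add: mult.commute cis_cnj)
    also have "\<dots> = cnj (integral {0..2*pi} (\<lambda>t. g (rcis r t) * cis (- (of_nat n * t))))"
      by (simp only: integral_cnj)
    finally show ?thesis by (simp add: tcoeff_integral[OF g r])
  qed
  with integral_power_series_circle[OF f r c]
  have "(\<lambda>n. tcoeff f n * of_real r ^ n * (2 * pi * of_real r ^ n * cnj (tcoeff g n))) sums
    integral {0..2*pi} (\<lambda>t. f (rcis r t) * cnj (g (rcis r t)))" by simp
  from sums_mult[OF this, of "of_real (1/(2*pi))"] show ?thesis
    by (simp add: power_mult power2_eq_square power_mult_distrib mult_ac)
qed

lemma Parseval_circle_norm:
  assumes f: "f holomorphic_on unit_disc" and r: "0 \<le> r" "r < 1"
  shows "(\<lambda>n. (norm (tcoeff f n))\<^sup>2 * r ^ (2*n)) sums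
           (1/(2*pi) * integral {0..2*pi} (\<lambda>t. (norm (f (rcis r t)))\<^sup>2))"
proof -
  have "integral {0..2*pi} (\<lambda>t. complex_of_real ((norm (f (rcis r t)))\<^sup>2)) =
    complex_of_real (integral {0..2*pi} (\<lambda>t. (norm (f (rcis r t)))\<^sup>2))"
    by (rule integral_unique, rule has_integral_of_real, rule integrable_integral,
        intro integrable_continuous_interval continuous_intros continuous_on_circle f r)
  with Parseval_circle[OF f f r]
  have "(\<lambda>n. of_real ((norm (tcoeff f n))\<^sup>2 * r ^ (2*n))) sums
           complex_of_real (1/(2*pi) * integral {0..2*pi} (\<lambda>t. (norm (f (rcis r t)))\<^sup>2))"
    by (simp add: mult_ac flip: complex_norm_square)
  then show ?thesis by (simp only: sums_of_real_iff)
qed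

section \<open>The Hardy space as a space of square-summable power series\<close>

text \<open>The squared \<open>H\<^sup>2\<close> norm.\<close>
definition energy :: "(complex \<Rightarrow> complex) \<Rightarrow> real" where
  "energy f = (\<Sum>n. (norm (tcoeff f n))\<^sup>2)"

text \<open>The inner product of \<open>H\<^sup>2\<close> in coefficient form, for which linearity and the Cauchy--Schwarz inequality are
  statements about absolutely convergent series.\<close>
definition coeff_inner :: "(complex \<Rightarrow> complex) \<Rightarrow> (complex \<Rightarrow> complex) \<Rightarrow> complex" where
  "coeff_inner f g = (\<Sum>n. tcoeff f n * cnj (tcoeff g n))"

text \<open>Bounds on the means over all circles of radius less than one pass to the coefficients, since
  every finite partial sum in Parseval's identity is continuous in \<open>r\<close> up to \<open>r = 1\<close>.\<close>
lemma square_summable_of_mean_bound: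
  assumes f: "f holomorphic_on unit_disc"
    and M: "\<And>r. 0 < r \<Longrightarrow> r < 1 \<Longrightarrow> integral {0..2*pi} (\<lambda>t. (norm (f (rcis r t)))\<^sup>2) \<le> 2 * pi * M"
  shows "summable (\<lambda>n. (norm (tcoeff f n))\<^sup>2)" and "energy f \<le> M"
proof -
  have partial: "(\<Sum>n<N. (norm (tcoeff f n))\<^sup>2) \<le> M" for N
  proof -
    have "((\<lambda>r::real. \<Sum>n<N. (norm (tcoeff f n))\<^sup>2 * r ^ (2*n)) \<longlongrightarrow> (\<Sum>n<N. (norm (tcoeff f n))\<^sup>2 * 1 ^ (2*n))) (at_left 1)"
      by (intro tendsto_intros)
    moreover have "eventually (\<lambda>r::real. (\<Sum>n<N. (norm (tcoeff f n))\<^sup>2 * r ^ (2*n)) \<le> M) (at_left 1)"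
    proof -
      have "(\<Sum>n<N. (norm (tcoeff f n))\<^sup>2 * r ^ (2*n)) \<le> M" if r: "0 < r" "r < 1" for r
      proof -
        note P = Parseval_circle_norm[OF f, of r]
        have "(\<Sum>n<N. (norm (tcoeff f n))\<^sup>2 * r ^ (2*n)) \<le> 1/(2*pi) * integral {0..2*pi} (\<lambda>t. (norm (f (rcis r t)))\<^sup>2)"
          using sum_le_suminf[OF sums_summable[OF P], of "{..<N}"] sums_unique[OF P] r by simp
        also have "\<dots> \<le> M" using M[OF r] by (simp add: field_simps)
        finally show ?thesis .
      qed
      then show ?thesis by (auto simp: eventually_at_left_field intro: exI[of _ 0])
    qed
    ultimately show ?thesis
      using tendsto_upperbound[of _ _ "at_left (1::real)"] by force
  qed
  show s: "summable (\<lambda>n. (norm (tcoeff f n))\<^sup>2)"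
    by (rule summableI_nonneg_bounded[OF _ partial]) simp
  show "energy f \<le> M" unfolding energy_def by (rule suminf_le_const[OF s partial])
qed

lemma circle_integral_le_energy:
  assumes f: "f holomorphic_on unit_disc" "summable (\<lambda>n. (norm (tcoeff f n))\<^sup>2)" and r: "0 < r" "r < 1"
  shows "integral {0..2*pi} (\<lambda>t. (norm (f (rcis r t)))\<^sup>2) \<le> 2 * pi * energy f"
proof -
  have P: "(\<lambda>n. (norm (tcoeff f n))\<^sup>2 * r ^ (2*n)) sums
         (1/(2*pi) * integral {0..2*pi} (\<lambda>t. (norm (f (rcis r t)))\<^sup>2))"
    using Parseval_circle_norm f r by simp
  have "(norm (tcoeff f n))\<^sup>2 * r ^ (2*n) \<le> (norm (tcoeff f n))\<^sup>2" for n
    using r by (simp add: mult_left_le power_le_one)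
  then have "1/(2*pi) * integral {0..2*pi} (\<lambda>t. (norm (f (rcis r t)))\<^sup>2) \<le> energy f"
    unfolding energy_def using f by (intro sums_le[OF _ P summable_sums]) auto
  then show ?thesis by (simp add: field_simps)
qed

lemma hardy2_iff_square_summable:
  "f \<in> hardy2 \<longleftrightarrow> f holomorphic_on unit_disc \<and> summable (\<lambda>n. (norm (tcoeff f n))\<^sup>2)"
proof (intro iffI conjI)
  assume f: "f \<in> hardy2"
  then show hol: "f holomorphic_on unit_disc" by (simp add: hardy2_def)
  obtain K where "\<forall>r\<in>{0<..<1}. sqrt (1/(2*pi) * integral {0..2*pi} (\<lambda>t. (norm (f (rcis r t)))\<^sup>2)) \<le> K"
    using f unfolding hardy2_def bdd_above_def by auto
  then have K: "sqrt (1/(2*pi) * integral {0..2*pi} (\<lambda>t. (norm (f (rcis r t)))\<^sup>2)) \<le> K" if "0 < r" "r < 1" for r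
    using that by (meson greaterThanLessThan_iff)
  show "summable (\<lambda>n. (norm (tcoeff f n))\<^sup>2)"
  proof (rule square_summable_of_mean_bound(1)[OF hol])
    fix r :: real assume "0 < r" "r < 1"
    from sqrt_le_D[OF K[OF this]]
    show "integral {0..2*pi} (\<lambda>t. (norm (f (rcis r t)))\<^sup>2) \<le> 2 * pi * K\<^sup>2"
      by (simp add: field_simps)
  qed
next
  assume f: "f holomorphic_on unit_disc \<and> summable (\<lambda>n. (norm (tcoeff f n))\<^sup>2)"
  then have "sqrt (1/(2*pi) * integral {0..2*pi} (\<lambda>t. (norm (f (rcis r t)))\<^sup>2)) \<le> sqrt (energy f)"
    if "0 < r" "r < 1" for r
    using circle_integral_le_energy[of f r] that by (intro real_sqrt_le_mono) (simp add: field_simps)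
  then show "f \<in> hardy2" using f by (auto simp: hardy2_def intro!: bdd_aboveI2[where M="sqrt (energy f)"])
qed

lemma hardy2_holomorphic: "f \<in> hardy2 \<Longrightarrow> f holomorphic_on unit_disc"
  and hardy2_summable: "f \<in> hardy2 \<Longrightarrow> summable (\<lambda>n. (norm (tcoeff f n))\<^sup>2)"
  by (simp_all add: hardy2_iff_square_summable)

lemma circle_integral_le:
  assumes "f holomorphic_on unit_disc" "0 < r" "r < 1"
    and "\<And>t. (norm (f (rcis r t)))\<^sup>2 \<le> C"
  shows "integral {0..2*pi} (\<lambda>t. (norm (f (rcis r t)))\<^sup>2) \<le> 2 * pi * C"
proof -
  have "integral {0..2*pi} (\<lambda>t. (norm (f (rcis r t)))\<^sup>2) \<le> integral {0..2*pi} (\<lambda>t. C)"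
    using assms
    by (intro integral_le integrable_continuous_interval continuous_intros continuous_on_circle) auto
  then show ?thesis by simp
qed

lemma hardy2_bounded:
  assumes f: "f holomorphic_on unit_disc" and "\<And>z. norm z < 1 \<Longrightarrow> norm (f z) \<le> C"
  shows "f \<in> hardy2" 
proof -
  have "integral {0..2*pi} (\<lambda>t. (norm (f (rcis r t)))\<^sup>2) \<le> 2 * pi * C\<^sup>2" if "0 < r" "r < 1" for r
    using that by (intro circle_integral_le f power_mono assms) auto
  from square_summable_of_mean_bound(1)[OF f this]
  show "f \<in> hardy2" using f by (simp add: hardy2_iff_square_summable)
qed

lemma energy_nonneg: "f \<in> hardy2 \<Longrightarrow> 0 \<le> energy f"
  unfolding energy_def by (intro suminf_nonneg hardy2_summable) auto

text \<open>The Cauchy--Schwarz inequality in \<open>\<ell>\<^sup>2\<close>, obtained from the finite one by a limit of partial sums.\<close>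
lemma coeff_products_le:
  assumes "f \<in> hardy2" "g \<in> hardy2"
  shows "summable (\<lambda>n. norm (tcoeff f n * cnj (tcoeff g n)))"
    and "(\<Sum>n. norm (tcoeff f n * cnj (tcoeff g n))) \<le> sqrt (energy f * energy g)"
proof -
  have "(\<Sum>n<N. norm (tcoeff f n * cnj (tcoeff g n))) \<le> sqrt (energy f * energy g)" for N
  proof (rule real_le_rsqrt)
    have "(\<Sum>n<N. norm (tcoeff f n * cnj (tcoeff g n)))\<^sup>2
        \<le> (\<Sum>n<N. (norm (tcoeff f n))\<^sup>2) * (\<Sum>n<N. (norm (tcoeff g n))\<^sup>2)"
      by (simp add: norm_mult Cauchy_Schwarz_ineq_sum)
    also have "\<dots> \<le> energy f * energy g" unfolding energy_def
      by (intro mult_mono sum_le_suminf suminf_nonneg hardy2_summable assms sum_nonneg) auto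
    finally show "(\<Sum>n<N. norm (tcoeff f n * cnj (tcoeff g n)))\<^sup>2 \<le> energy f * energy g" .
  qed
  note partial = this
  show s: "summable (\<lambda>n. norm (tcoeff f n * cnj (tcoeff g n)))"
    by (rule summableI_nonneg_bounded[OF _ partial]) simp
  show "(\<Sum>n. norm (tcoeff f n * cnj (tcoeff g n))) \<le> sqrt (energy f * energy g)"
    by (rule suminf_le_const[OF s partial])
qed

lemma coeff_inner_sums:
  assumes "f \<in> hardy2" "g \<in> hardy2"
  shows "(\<lambda>n. tcoeff f n * cnj (tcoeff g n)) sums coeff_inner f g"
  unfolding coeff_inner_def
  by (intro summable_sums summable_norm_cancel[OF coeff_products_le(1)] assms)

lemma coeff_inner_Cauchy_Schwarz:
  assumes "f \<in> hardy2" "g \<in> hardy2"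
  shows "norm (coeff_inner f g) \<le> sqrt (energy f * energy g)"
  using summable_norm[OF coeff_products_le(1)[OF assms]] coeff_products_le(2)[OF assms]
  unfolding coeff_inner_def by linarith

text \<open>By Parseval the mean over the circle of radius \<open>r\<close> is a power series in \<open>r\<close> whose coefficients are
  absolutely summable; such a series is continuous up to \<open>r = 1\<close>.\<close>
lemma hardy2_inner_eq_coeff_inner:
  assumes f: "f \<in> hardy2" and g: "g \<in> hardy2"
  shows "hardy2_inner f g = coeff_inner f g"
proof -
  let ?x = "\<lambda>n. tcoeff f n * cnj (tcoeff g n)"
  have "uniform_limit {0..1} (\<lambda>N r::real. \<Sum>n<N. ?x n * of_real (r ^ (2*n)))
          (\<lambda>r. \<Sum>n. ?x n * of_real (r ^ (2*n))) sequentially"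
  proof (rule Weierstrass_m_test[OF _ coeff_products_le(1)[OF f g]])
    fix n and r :: real assume "r \<in> {0..1}"
    then show "norm (?x n * of_real (r ^ (2*n))) \<le> norm (?x n)"
      by (auto simp: norm_mult norm_power power_le_one intro!: mult_left_le)
  qed
  then have "continuous_on {0..1} (\<lambda>r::real. \<Sum>n. ?x n * of_real (r ^ (2*n)))"
    by (rule uniform_limit_theorem[rotated]) (auto intro!: always_eventually continuous_intros)
  then have "((\<lambda>r::real. \<Sum>n. ?x n * of_real (r ^ (2*n))) \<longlongrightarrow> (\<Sum>n. ?x n * of_real (1 ^ (2*n)))) (at 1 within {0..1})"
    unfolding continuous_on_def by (rule bspec) simp
  moreover have "at 1 within {0..1} = at_left (1::real)"
    by (rule at_within_Icc_at_left) simp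
  ultimately have lim: "((\<lambda>r::real. \<Sum>n. ?x n * of_real (r ^ (2*n))) \<longlongrightarrow> coeff_inner f g) (at_left 1)"
    by (simp add: coeff_inner_def)
  have "(\<Sum>n. ?x n * of_real (r ^ (2*n))) =
      of_real (1/(2*pi)) * integral {0..2*pi} (\<lambda>t. f (rcis r t) * cnj (g (rcis r t)))" if "0 < r" "r < 1" for r
    using sums_unique[OF Parseval_circle, of f g r] that hardy2_holomorphic f g by simp
  then have "eventually (\<lambda>r. (\<Sum>n. ?x n * of_real (r ^ (2*n))) =
      of_real (1/(2*pi)) * integral {0..2*pi} (\<lambda>t. f (rcis r t) * cnj (g (rcis r t)))) (at_left 1)"
    by (auto simp: eventually_at_left_field intro!: exI[of _ 0])
  from Lim_transform_eventually[OF lim this] show ?thesis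
    unfolding hardy2_inner_def by (intro tendsto_Lim) auto
qed

lemma coeff_inner_sum_right:
  assumes f: "f \<in> hardy2" and g: "\<And>i. i \<in> I \<Longrightarrow> g i \<in> hardy2"
  shows "coeff_inner f (\<lambda>w. \<Sum>i\<in>I. c i * g i w) = (\<Sum>i\<in>I. cnj (c i) * coeff_inner f (g i))"
proof -
  have "(\<lambda>n. \<Sum>i\<in>I. cnj (c i) * (tcoeff f n * cnj (tcoeff (g i) n))) sums (\<Sum>i\<in>I. cnj (c i) * coeff_inner f (g i))"
    by (intro sums_sum sums_mult coeff_inner_sums f g)
  then show ?thesis unfolding coeff_inner_def[of f "\<lambda>w. \<Sum>i\<in>I. c i * g i w"]
    by (subst tcoeff_sum) (simp_all add: hardy2_holomorphic[OF g] sums_iff cnj_sum sum_distrib_left mult_ac)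
qed

lemma coeff_inner_sum_left:
  assumes f: "\<And>i. i \<in> I \<Longrightarrow> f i \<in> hardy2" and g: "g \<in> hardy2" 
  shows "coeff_inner (\<lambda>w. \<Sum>i\<in>I. c i * f i w) g = (\<Sum>i\<in>I. c i * coeff_inner (f i) g)"
proof -
  have "(\<lambda>n. \<Sum>i\<in>I. c i * (tcoeff (f i) n * cnj (tcoeff g n))) sums (\<Sum>i\<in>I. c i * coeff_inner (f i) g)"
    by (intro sums_sum sums_mult coeff_inner_sums f g)
  then show ?thesis unfolding coeff_inner_def[of "\<lambda>w. \<Sum>i\<in>I. c i * f i w"]
    by (subst tcoeff_sum) (simp_all add: hardy2_holomorphic[OF f] sums_iff sum_distrib_left mult_ac)
qed

text \<open>The reproducing kernel of \<open>H\<^sup>2\<close> at \<open>z\<close>.\<close>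
definition szego :: "complex \<Rightarrow> complex \<Rightarrow> complex" where
  "szego z w = 1 / (1 - cnj z * w)"

lemma one_minus_cnj_mult_bound:
  assumes "norm z < 1" "norm w \<le> 1"
  shows "1 - norm z \<le> norm (1 - cnj z * w)" "1 - cnj z * w \<noteq> 0"
proof -
  have "norm (cnj z * w) \<le> norm z" using assms by (simp add: norm_mult mult_left_le)
  with norm_triangle_ineq2[of 1 "cnj z * w"]
  show *: "1 - norm z \<le> norm (1 - cnj z * w)" by simp
  with assms show "1 - cnj z * w \<noteq> 0" by auto
qed

lemma szego_holomorphic: "norm z < 1 \<Longrightarrow> szego z holomorphic_on unit_disc"
  unfolding szego_def using one_minus_cnj_mult_bound(2) by (intro holomorphic_intros) auto

lemma norm_szego_le: "norm z < 1 \<Longrightarrow> norm w \<le> 1 \<Longrightarrow> norm (szego z w) \<le> 1 / (1 - norm z)"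
  unfolding szego_def norm_divide norm_one using one_minus_cnj_mult_bound(1)[of z w]
  by (intro divide_left_mono mult_pos_pos) auto

lemma szego_hardy2: "norm z < 1 \<Longrightarrow> szego z \<in> hardy2"
  by (rule hardy2_bounded[OF szego_holomorphic norm_szego_le]) auto

lemma tcoeff_szego:
  assumes "norm z < 1" shows "tcoeff (szego z) n = cnj z ^ n"
proof (rule tcoeff_unique)
  fix w :: complex assume "norm w < 1"
  then have "norm (cnj z * w) < 1" using assms
    by (simp add: norm_mult) (metis mult_strict_mono' mult_1 norm_ge_zero)
  from geometric_sums[OF this] show "(\<lambda>n. cnj z ^ n * w ^ n) sums szego z w"
    by (simp add: szego_def power_mult_distrib)
qed

text \<open>The Szego kernel reproduces: its coefficients are the powers of \<open>cnj z\<close>, so the inner product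
  with it is literally the power series at \<open>z\<close>.\<close>
lemma coeff_inner_szego:
  assumes "f holomorphic_on unit_disc" "norm z < 1"
  shows "coeff_inner f (szego z) = f z"
  using tcoeff_sums[OF assms] by (simp add: coeff_inner_def tcoeff_szego assms sums_iff)

lemma szego_coeff_inner:
  assumes "f holomorphic_on unit_disc" "norm z < 1"
  shows "coeff_inner (szego z) f = cnj (f z)"
  using sums_cnj[THEN iffD2, OF tcoeff_sums[OF assms]]
  by (simp add: coeff_inner_def tcoeff_szego assms sums_iff mult.commute)

lemma energy_szego:
  assumes "norm z < 1" shows "energy (szego z) = 1 / (1 - (norm z)\<^sup>2)"
  using sums_unique[OF geometric_sums[of "(norm z)\<^sup>2"]] assms
  by (simp add: energy_def tcoeff_szego norm_power power_one_over abs_square_less_1 flip: power_mult) (simp add: mult.commute)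

section \<open>Blaschke products\<close>

definition blaschke_factor :: "complex \<Rightarrow> complex \<Rightarrow> complex" where
  "blaschke_factor a z = cnj a / of_real (norm a) * ((a - z) / (1 - cnj a * z))"

definition partial_blaschke :: "(nat \<Rightarrow> complex) \<Rightarrow> nat \<Rightarrow> complex \<Rightarrow> complex" where
  "partial_blaschke a N z = (\<Prod>n<N. blaschke_factor (a n) z)"

lemma blaschke_product_eq: "blaschke_product a z = (\<Prod>n. blaschke_factor (a n) z)"
  by (simp add: blaschke_product_def blaschke_factor_def)

text \<open>The defect of a single Blaschke factor in the Szego kernel has rank one. Both
  the bound by one on the disc and the kernel expansion of a finite Blaschke product rest on this identity.\<close>
lemma blaschke_factor_kernel_identity:
  assumes "a \<noteq> 0" "norm a < 1" "norm z < 1" "norm w < 1"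
  shows "szego z w * (1 - cnj (blaschke_factor a z) * blaschke_factor a w) =
           of_real (1 - (norm a)\<^sup>2) * cnj (szego a z) * szego a w"
proof -
  have "cnj a * a / (of_real (norm a) * of_real (norm a)) = 1"
    using assms(1) by (simp add: complex_norm_square[symmetric] power2_eq_square mult.commute)
  moreover have "cnj (blaschke_factor a z) * blaschke_factor a w = cnj a * a / (of_real (norm a) * of_real (norm a)) *
      ((cnj a - cnj z) * (a - w) / ((1 - a * cnj z) * (1 - cnj a * w)))"
    unfolding blaschke_factor_def by (simp add: mult_ac)
  ultimately have *: "cnj (blaschke_factor a z) * blaschke_factor a w =
      (cnj a - cnj z) * (a - w) / ((1 - a * cnj z) * (1 - cnj a * w))"
    by simp
  have nz: "1 - cnj z * w \<noteq> 0" "1 - a * cnj z \<noteq> 0" "1 - cnj a * w \<noteq> 0"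
    using one_minus_cnj_mult_bound(2)[of z w] one_minus_cnj_mult_bound(2)[of z a]
      one_minus_cnj_mult_bound(2)[of a w] assms by (auto simp: mult.commute)
  have num: "(1 - a * cnj z) * (1 - cnj a * w) - (cnj a - cnj z) * (a - w) = (1 - a * cnj a) * (1 - cnj z * w)"
    by (simp add: algebra_simps)
  have "1 - cnj (blaschke_factor a z) * blaschke_factor a w =
      ((1 - a * cnj z) * (1 - cnj a * w) - (cnj a - cnj z) * (a - w)) / ((1 - a * cnj z) * (1 - cnj a * w))"
    unfolding * using nz by (simp add: diff_divide_distrib)
  also have "\<dots> = (1 - a * cnj a) * (1 - cnj z * w) / ((1 - a * cnj z) * (1 - cnj a * w))"
    unfolding num ..
  finally show ?thesis
    using nz by (simp add: szego_def complex_norm_square del: of_real_power)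
qed

lemma one_minus_norm_blaschke_factor:
  assumes "a \<noteq> 0" "norm a < 1" "norm z < 1"
  shows "1 - (norm (blaschke_factor a z))\<^sup>2 = (1 - (norm a)\<^sup>2) * (1 - (norm z)\<^sup>2) * (norm (szego a z))\<^sup>2"
proof -
  have "of_real (1 - (norm (blaschke_factor a z))\<^sup>2) * szego z z =
      complex_of_real ((1 - (norm a)\<^sup>2) * (norm (szego a z))\<^sup>2)"
    using blaschke_factor_kernel_identity[OF assms assms(3)]
    by (simp add: complex_norm_square mult_ac del: of_real_power)
  moreover have "szego z z = complex_of_real (1 / (1 - (norm z)\<^sup>2))"
    by (simp add: szego_def complex_norm_square mult.commute del: of_real_power)
  ultimately have "(1 - (norm (blaschke_factor a z))\<^sup>2) * (1 / (1 - (norm z)\<^sup>2)) =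
      (1 - (norm a)\<^sup>2) * (norm (szego a z))\<^sup>2"
    by (simp only: of_real_mult[symmetric] of_real_eq_iff)
  moreover have "1 - (norm z)\<^sup>2 \<noteq> 0" using assms(3) abs_square_less_1[of "norm z"] by simp
  ultimately show ?thesis by (simp add: field_simps)
qed

lemma norm_blaschke_factor_le:
  assumes "a \<noteq> 0" "norm a < 1" "norm z < 1"
  shows "norm (blaschke_factor a z) \<le> 1"
proof -
  have "0 \<le> (1 - (norm a)\<^sup>2) * (1 - (norm z)\<^sup>2) * (norm (szego a z))\<^sup>2"
    using assms by (simp add: power_le_one)
  then have "(norm (blaschke_factor a z))\<^sup>2 \<le> 1"
    unfolding one_minus_norm_blaschke_factor[OF assms, symmetric] by simp
  then show ?thesis by (simp add: abs_square_le_1)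
qed

lemma blaschke_factor_holomorphic: "norm a < 1 \<Longrightarrow> blaschke_factor a holomorphic_on unit_disc"
  unfolding blaschke_factor_def
  using one_minus_cnj_mult_bound(2)[of a] by (cases "a = 0") (auto intro!: holomorphic_intros)

text \<open>The unimodular constant in the factor is chosen so that the factor tends to one as its zero
  approaches the circle; this rate makes the infinite product converge locally uniformly.\<close>
lemma blaschke_factor_minus_one:
  assumes "a \<noteq> 0" "norm a < 1" "norm z < 1"
  shows "norm (blaschke_factor a z - 1) \<le> (1 - norm a) * (2 / (1 - norm z))"
proof -
  have nz: "1 - cnj a * z \<noteq> 0" using one_minus_cnj_mult_bound(2)[of a z] assms by auto
  have "cnj a * a = complex_of_real (norm a) * of_real (norm a)"
    using complex_norm_square[of a] by (simp add: power2_eq_square mult.commute)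
  then have "blaschke_factor a z - 1 =
      - (of_real (1 - norm a) * (1 + cnj a / of_real (norm a) * z) / (1 - cnj a * z))"
    using assms(1) nz unfolding blaschke_factor_def by (simp add: field_simps)
  then have "norm (blaschke_factor a z - 1) = (1 - norm a) * (norm (1 + cnj a / of_real (norm a) * z) / norm (1 - cnj a * z))"
    using assms(2) norm_of_real[of "1 - norm a", where 'a=complex] by (simp add: norm_mult norm_divide)
  also have "\<dots> \<le> (1 - norm a) * (2 / (1 - norm z))"
  proof (intro mult_left_mono frac_le)
    show "norm (1 + cnj a / of_real (norm a) * z) \<le> 2"
      using norm_triangle_ineq[of 1 "cnj a / of_real (norm a) * z"] assms by (simp add: norm_mult norm_divide)
    show "1 - norm z \<le> norm (1 - cnj a * z)"
      using one_minus_cnj_mult_bound(1)[of z a] assms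
      by (metis complex_cnj_cnj complex_cnj_diff complex_cnj_mult complex_cnj_one complex_mod_cnj less_imp_le mult.commute)
  qed (use assms in auto)
  finally show ?thesis .
qed

lemma partial_blaschke_0 [simp]: "partial_blaschke a 0 z = 1"
  by (simp add: partial_blaschke_def)

lemma partial_blaschke_Suc: "partial_blaschke a (Suc N) z = partial_blaschke a N z * blaschke_factor (a N) z"
  by (simp add: partial_blaschke_def)

lemma blaschke_sequenceD:
  assumes "blaschke_sequence a"
  shows "a n \<noteq> 0" "norm (a n) < 1" "summable (\<lambda>n. 1 - norm (a n))"
  using assms by (auto simp: blaschke_sequence_def)

lemma partial_blaschke_holomorphic:
  "blaschke_sequence a \<Longrightarrow> partial_blaschke a N holomorphic_on unit_disc"
  unfolding partial_blaschke_def
  by (intro holomorphic_on_prod blaschke_factor_holomorphic blaschke_sequenceD)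

lemma norm_partial_blaschke_le:
  "blaschke_sequence a \<Longrightarrow> norm z < 1 \<Longrightarrow> norm (partial_blaschke a N z) \<le> 1"
  unfolding partial_blaschke_def prod_norm[symmetric]
  by (intro prod_le_1) (auto intro!: norm_blaschke_factor_le blaschke_sequenceD)

lemma partial_blaschke_zero: "n < N \<Longrightarrow> partial_blaschke a N (a n) = 0"
  unfolding partial_blaschke_def by (auto simp: blaschke_factor_def)

lemma blaschke_convergent:
  assumes a: "blaschke_sequence a" and z: "norm z < 1"
  shows "convergent_prod (\<lambda>n. blaschke_factor (a n) z)"
proof -
  have "summable (\<lambda>n. norm (blaschke_factor (a n) z - 1))"
  proof (rule summable_comparison_test')
    show "summable (\<lambda>n. (1 - norm (a n)) * (2 / (1 - norm z)))"
      by (intro summable_mult2 blaschke_sequenceD a)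
    show "norm (norm (blaschke_factor (a n) z - 1)) \<le> (1 - norm (a n)) * (2 / (1 - norm z))" for n
      using blaschke_factor_minus_one[OF blaschke_sequenceD(1,2)[OF a] z] by simp
  qed
  then show ?thesis
    by (intro abs_convergent_prod_imp_convergent_prod)
       (simp add: abs_convergent_prod_conv_summable)
qed

lemma partial_blaschke_tendsto:
  assumes "blaschke_sequence a" "norm z < 1"
  shows "(\<lambda>N. partial_blaschke a N z) \<longlonglongrightarrow> blaschke_product a z"
  using convergent_prod_LIMSEQ[OF blaschke_convergent[OF assms]]
  unfolding partial_blaschke_def blaschke_product_eq LIMSEQ_lessThan_iff_atMost .

lemma blaschke_product_holomorphic:
  assumes a: "blaschke_sequence a"
  shows "blaschke_product a holomorphic_on unit_disc"
proof (rule holomorphic_uniform_sequence[where f = "partial_blaschke a"])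
  fix x assume x: "x \<in> unit_disc"
  define \<rho> where "\<rho> = (1 + norm x) / 2"
  have \<rho>: "\<rho> < 1" using x by (simp add: \<rho>_def)
  have sub: "cball x ((1 - norm x) / 2) \<subseteq> cball 0 \<rho>"
    by (simp add: \<rho>_def cball_subset_cball_iff field_simps)
  have "uniformly_convergent_on (cball 0 \<rho>) (\<lambda>N z. \<Prod>n<N. blaschke_factor (a n) z)"
  proof (rule uniformly_convergent_on_prod')
    show "continuous_on (cball 0 \<rho>) (blaschke_factor (a n))" for n
      by (rule continuous_on_subset[OF holomorphic_on_imp_continuous_on[OF blaschke_factor_holomorphic]])
         (use blaschke_sequenceD[OF a] \<rho> in auto)
    show "uniformly_convergent_on (cball 0 \<rho>) (\<lambda>N z. \<Sum>n<N. norm (blaschke_factor (a n) z - 1))"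
    proof (rule Weierstrass_m_test')
      show "summable (\<lambda>n. (1 - norm (a n)) * (2 / (1 - \<rho>)))"
        by (intro summable_mult2 blaschke_sequenceD a)
      show "norm (norm (blaschke_factor (a n) z - 1)) \<le> (1 - norm (a n)) * (2 / (1 - \<rho>))"
        if z: "z \<in> cball 0 \<rho>" for n z
      proof -
        have "norm (norm (blaschke_factor (a n) z - 1)) \<le> (1 - norm (a n)) * (2 / (1 - norm z))"
          using blaschke_factor_minus_one[OF blaschke_sequenceD(1,2)[OF a], of z n] z \<rho> by auto
        also have "\<dots> \<le> (1 - norm (a n)) * (2 / (1 - \<rho>))"
          using z \<rho> blaschke_sequenceD(2)[OF a, of n] by (intro mult_left_mono divide_left_mono) auto
        finally show "norm (norm (blaschke_factor (a n) z - 1)) \<le> (1 - norm (a n)) * (2 / (1 - \<rho>))" .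
      qed
    qed
  qed auto
  then obtain l where l: "uniform_limit (cball 0 \<rho>) (partial_blaschke a) l sequentially"
    unfolding uniformly_convergent_on_def partial_blaschke_def[abs_def] by blast
  have "l z = blaschke_product a z" if "z \<in> cball 0 \<rho>" for z
    using tendsto_uniform_limitI[OF l that] partial_blaschke_tendsto[OF a, of z] that \<rho>
    by (auto intro: LIMSEQ_unique)
  then have "uniform_limit (cball 0 \<rho>) (partial_blaschke a) (blaschke_product a) sequentially"
    using l uniform_limit_cong'[of "cball 0 \<rho>" "partial_blaschke a" "partial_blaschke a" l "blaschke_product a" sequentially]
    by simp
  then have "uniform_limit (cball x ((1 - norm x) / 2)) (partial_blaschke a) (blaschke_product a) sequentially"
    using sub by (rule uniform_limit_on_subset)
  moreover have "cball x ((1 - norm x) / 2) \<subseteq> unit_disc" using sub \<rho> by force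
  ultimately show "\<exists>d>0. cball x d \<subseteq> unit_disc \<and> uniform_limit (cball x d) (partial_blaschke a) (blaschke_product a) sequentially"
    using x by (intro exI[of _ "(1 - norm x) / 2"]) auto
qed (auto intro: partial_blaschke_holomorphic a)

lemma norm_blaschke_product_le:
  assumes "blaschke_sequence a" "norm z < 1"
  shows "norm (blaschke_product a z) \<le> 1"
  by (rule LIMSEQ_le_const2[OF tendsto_norm[OF partial_blaschke_tendsto[OF assms]]])
     (use norm_partial_blaschke_le assms in auto)

lemma blaschke_sequence_shift: "blaschke_sequence a \<Longrightarrow> blaschke_sequence (\<lambda>n. a (n + N))"
  unfolding blaschke_sequence_def using summable_ignore_initial_segment by blast

lemma blaschke_product_split:
  assumes a: "blaschke_sequence a" and z: "norm z < 1"
  shows "blaschke_product a z = partial_blaschke a N z * blaschke_product (\<lambda>n. a (n + N)) z"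
proof (rule LIMSEQ_unique)
  show "(\<lambda>M. partial_blaschke a (M + N) z) \<longlonglongrightarrow> blaschke_product a z"
    using LIMSEQ_ignore_initial_segment[OF partial_blaschke_tendsto[OF assms]] .
  have "partial_blaschke a (M + N) z = partial_blaschke a N z * partial_blaschke (\<lambda>n. a (n + N)) M z" for M
    by (induction M) (simp_all add: partial_blaschke_Suc mult_ac)
  then show "(\<lambda>M. partial_blaschke a (M + N) z) \<longlonglongrightarrow> partial_blaschke a N z * blaschke_product (\<lambda>n. a (n + N)) z"
    using tendsto_mult_left[OF partial_blaschke_tendsto[OF blaschke_sequence_shift[OF a] z]] by simp
qed

text \<open>The origin is not a zero, so the product converges there to a non-zero value and
  its tails tend to one.\<close>
lemma blaschke_tail_at_0:
  assumes a: "blaschke_sequence a"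
  shows "(\<lambda>N. blaschke_product (\<lambda>n. a (n + N)) 0) \<longlonglongrightarrow> 1"
proof -
  have nz: "blaschke_factor (a n) 0 \<noteq> 0" for n
    using blaschke_sequenceD[OF a] by (simp add: blaschke_factor_def)
  have B0: "blaschke_product a 0 \<noteq> 0"
    unfolding blaschke_product_eq by (rule prodinf_nonzero[OF blaschke_convergent[OF a]]) (use nz in auto)
  have "partial_blaschke a N 0 \<noteq> 0" for N using nz by (simp add: partial_blaschke_def)
  then have "blaschke_product (\<lambda>n. a (n + N)) 0 = blaschke_product a 0 / partial_blaschke a N 0" for N
    using blaschke_product_split[OF a, of 0 N] by (simp add: field_simps)
  moreover have "(\<lambda>N. blaschke_product a 0 / partial_blaschke a N 0) \<longlonglongrightarrow> blaschke_product a 0 / blaschke_product a 0"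
    by (intro tendsto_divide tendsto_const partial_blaschke_tendsto a B0) simp
  ultimately show ?thesis using B0 by simp
qed

section \<open>Approximating the model space by sums of kernels\<close>

definition kernel_span :: "(nat \<Rightarrow> complex) \<Rightarrow> nat set \<Rightarrow> (complex \<Rightarrow> complex) set" where
  "kernel_span a S = {g. \<exists>c. \<forall>w\<in>unit_disc. g w = (\<Sum>i\<in>S. c i * szego (a i) w)}"

lemma kernel_span_mono:
  assumes "S \<subseteq> T" "finite T" "g \<in> kernel_span a S"
  shows "g \<in> kernel_span a T"
proof -
  from assms(3) obtain c where c: "\<forall>w\<in>unit_disc. g w = (\<Sum>i\<in>S. c i * szego (a i) w)"
    unfolding kernel_span_def by blast
  have "(\<Sum>i\<in>S. c i * szego (a i) w) = (\<Sum>i\<in>T. (if i \<in> S then c i else 0) * szego (a i) w)" for w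
    using assms by (intro sum.mono_neutral_cong_left) auto
  then have "\<forall>w\<in>unit_disc. g w = (\<Sum>i\<in>T. (if i \<in> S then c i else 0) * szego (a i) w)" using c by simp
  then show ?thesis unfolding kernel_span_def mem_Collect_eq by (rule exI[of _ "\<lambda>i. if i \<in> S then c i else 0"])
qed

lemma kernel_span_combination:
  assumes "\<And>j. j \<in> J \<Longrightarrow> g j \<in> kernel_span a S"
  shows "(\<lambda>w. \<Sum>j\<in>J. d j * g j w) \<in> kernel_span a S"
proof -
  from assms obtain c where c: "\<And>j w. j \<in> J \<Longrightarrow> w \<in> unit_disc \<Longrightarrow> g j w = (\<Sum>i\<in>S. c j i * szego (a i) w)"
    unfolding kernel_span_def mem_Collect_eq by metis
  have "(\<Sum>j\<in>J. d j * g j w) = (\<Sum>i\<in>S. (\<Sum>j\<in>J. d j * c j i) * szego (a i) w)" if "w \<in> unit_disc" for w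
  proof -
    have "(\<Sum>j\<in>J. d j * g j w) = (\<Sum>j\<in>J. \<Sum>i\<in>S. d j * c j i * szego (a i) w)"
      using c that by (simp add: sum_distrib_left mult.assoc)
    also have "\<dots> = (\<Sum>i\<in>S. \<Sum>j\<in>J. d j * c j i * szego (a i) w)" by (rule sum.swap)
    finally show ?thesis by (simp add: sum_distrib_right)
  qed
  then show ?thesis unfolding kernel_span_def mem_Collect_eq by (intro exI ballI)
qed

text \<open>Partial fractions: two distinct poles can be separated, and the two residues determine \<open>A\<close> and
  \<open>\<alpha> - A\<close>.\<close>
lemma blaschke_factor_times_szego:
  assumes "norm \<alpha> < 1" "norm \<beta> < 1" "\<alpha> \<noteq> \<beta>" "norm w < 1"
  defines "A \<equiv> (1 - \<alpha> * cnj \<alpha>) / (cnj \<beta> - cnj \<alpha>)"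
  shows "blaschke_factor \<alpha> w * szego \<beta> w =
    cnj \<alpha> / of_real (norm \<alpha>) * (A * szego \<alpha> w + (\<alpha> - A) * szego \<beta> w)"
proof -
  have nz: "1 - cnj \<alpha> * w \<noteq> 0" "1 - cnj \<beta> * w \<noteq> 0" "cnj \<beta> - cnj \<alpha> \<noteq> 0"
    using one_minus_cnj_mult_bound(2)[of \<alpha> w] one_minus_cnj_mult_bound(2)[of \<beta> w] assms by auto
  have "A * (cnj \<beta> - cnj \<alpha>) = 1 - \<alpha> * cnj \<alpha>" using nz by (simp add: A_def)
  then have "A * (1 - cnj \<beta> * w) + (\<alpha> - A) * (1 - cnj \<alpha> * w) = \<alpha> - w"
    by algebra
  then have "(\<alpha> - w) / ((1 - cnj \<alpha> * w) * (1 - cnj \<beta> * w)) =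
     A / (1 - cnj \<alpha> * w) + (\<alpha> - A) / (1 - cnj \<beta> * w)"
    using nz by (simp add: add_frac_eq mult.commute)
  then show ?thesis unfolding blaschke_factor_def szego_def by (simp add: divide_simps)
qed

text \<open>Multiplication by a Blaschke factor with a new zero adds only the kernel at that zero. The
  distinctness of the zeros is essential: a double zero would bring in a derivative of the kernel.\<close>
lemma kernel_span_blaschke_factor:
  assumes a: "blaschke_sequence a" and "inj a" and S: "finite S" "m \<notin> S" and g: "g \<in> kernel_span a S"
  shows "(\<lambda>w. blaschke_factor (a m) w * g w) \<in> kernel_span a (insert m S)"
proof -
  from g obtain c where c: "\<forall>w\<in>unit_disc. g w = (\<Sum>i\<in>S. c i * szego (a i) w)"
    unfolding kernel_span_def by blast
  let ?A = "\<lambda>i. (1 - a m * cnj (a m)) / (cnj (a i) - cnj (a m))"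
  let ?u = "cnj (a m) / of_real (norm (a m))"
  let ?d = "\<lambda>i. if i = m then \<Sum>i\<in>S. c i * ?u * ?A i else c i * ?u * (a m - ?A i)"
  have "blaschke_factor (a m) w * g w = (\<Sum>i\<in>insert m S. ?d i * szego (a i) w)" if w: "w \<in> unit_disc" for w
  proof -
    have "blaschke_factor (a m) w * g w = (\<Sum>i\<in>S. c i * (blaschke_factor (a m) w * szego (a i) w))"
      using c w by (simp add: sum_distrib_left mult_ac)
    also have "\<dots> = (\<Sum>i\<in>S. c i * (?u * (?A i * szego (a m) w + (a m - ?A i) * szego (a i) w)))"
    proof (rule sum.cong[OF refl])
      fix i assume "i \<in> S"
      then have "a m \<noteq> a i" using S \<open>inj a\<close> by (auto dest: injD)
      then show "c i * (blaschke_factor (a m) w * szego (a i) w) =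
          c i * (?u * (?A i * szego (a m) w + (a m - ?A i) * szego (a i) w))"
        using blaschke_factor_times_szego[of "a m" "a i" w] blaschke_sequenceD[OF a] w by simp
    qed
    also have "\<dots> = (\<Sum>i\<in>S. c i * ?u * ?A i) * szego (a m) w + (\<Sum>i\<in>S. c i * ?u * (a m - ?A i) * szego (a i) w)"
      by (simp add: sum_distrib_right sum.distrib ring_distribs mult.assoc)
    also have "(\<Sum>i\<in>S. c i * ?u * (a m - ?A i) * szego (a i) w) = (\<Sum>i\<in>S. ?d i * szego (a i) w)"
      using S by (intro sum.cong) auto
    finally show ?thesis using S by simp
  qed
  then show ?thesis unfolding kernel_span_def mem_Collect_eq by (intro exI[of _ ?d] ballI)
qed

text \<open>These functions form, up to normalization, the Takenaka--Malmquist orthogonal system. They lie in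
  the span because the factors are built up one at a time and each new zero differs from all the kernel points so far.\<close>
lemma takenaka_in_kernel_span:
  assumes a: "blaschke_sequence a" and "inj a" and "n < N"
  shows "(\<lambda>w. partial_blaschke a n w * szego (a n) w) \<in> kernel_span a {..<N}"
proof -
  have "(\<lambda>w. partial_blaschke a j w * szego (a n) w) \<in> kernel_span a (insert n {..<j})" if "j \<le> n" for j
    using that
  proof (induction j)
    case 0
    show ?case unfolding kernel_span_def mem_Collect_eq by (rule exI[of _ "\<lambda>_. 1"]) simp
  next
    case (Suc j)
    then have "(\<lambda>w. blaschke_factor (a j) w * (partial_blaschke a j w * szego (a n) w))
        \<in> kernel_span a (insert j (insert n {..<j}))"
      by (intro kernel_span_blaschke_factor assms) auto
    moreover have "insert j (insert n {..<j}) = insert n {..<Suc j}" by auto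
    ultimately show ?case by (simp add: partial_blaschke_Suc mult_ac)
  qed
  from kernel_span_mono[OF _ _ this[OF order_refl], of "{..<N}"] \<open>n < N\<close> show ?thesis by auto
qed

text \<open>The reproducing kernel of the model space of a finite Blaschke product, expanded in the
  Takenaka--Malmquist system; each induction step applies the rank-one identity for one factor.\<close>
lemma takenaka_kernel_identity:
  assumes a: "blaschke_sequence a" and z: "norm z < 1" and w: "norm w < 1"
  shows "szego z w = cnj (partial_blaschke a N z) * (partial_blaschke a N w * szego z w) +
    (\<Sum>n<N. of_real (1 - (norm (a n))\<^sup>2) * cnj (partial_blaschke a n z * szego (a n) z)
       * (partial_blaschke a n w * szego (a n) w))"
proof (induction N)
  case (Suc N)
  have "cnj (partial_blaschke a N z) * partial_blaschke a N w *
      (szego z w * (1 - cnj (blaschke_factor (a N) z) * blaschke_factor (a N) w)) =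
      cnj (partial_blaschke a N z) * partial_blaschke a N w *
      (of_real (1 - (norm (a N))\<^sup>2) * cnj (szego (a N) z) * szego (a N) w)"
    using blaschke_factor_kernel_identity[of "a N" z w] blaschke_sequenceD[OF a] z w by simp
  with Suc.IH show ?case
    unfolding partial_blaschke_Suc sum.lessThan_Suc complex_cnj_mult by algebra
qed simp

lemma bounded_times_szego_hardy2:
  assumes "g holomorphic_on unit_disc" "\<And>w. norm w < 1 \<Longrightarrow> norm (g w) \<le> 1" "norm z < 1"
  shows "(\<lambda>w. g w * szego z w) \<in> hardy2"
proof (rule hardy2_bounded)
  show "(\<lambda>w. g w * szego z w) holomorphic_on unit_disc"
    by (intro holomorphic_intros assms szego_holomorphic)
  fix w :: complex assume w: "norm w < 1"
  have "norm (g w) * norm (szego z w) \<le> 1 * (1 / (1 - norm z))"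
    using w assms by (intro mult_mono norm_szego_le) auto
  then show "norm (g w * szego z w) \<le> 1 / (1 - norm z)" by (simp add: norm_mult)
qed

text \<open>Partial products converge in \<open>H\<^sup>2\<close>. The difference of the two products is the partial product
  times \<open>1 - R\<close>, where \<open>R\<close> is the tail and is bounded by one. Hence its squared modulus is at most
  \<open>2 - 2 Re R\<close>, a harmonic function, and the mean value property evaluates its mean
  as the value at the origin.\<close>
lemma energy_partial_blaschke_error:
  assumes a: "blaschke_sequence a" and z: "norm z < 1"
  shows "energy (\<lambda>w. partial_blaschke a N w * szego z w - blaschke_product a w * szego z w)
    \<le> (2 - 2 * Re (blaschke_product (\<lambda>n. a (n + N)) 0)) / (1 - norm z)\<^sup>2"
proof (rule square_summable_of_mean_bound(2))
  define R where "R = blaschke_product (\<lambda>n. a (n + N))"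
  let ?d = "\<lambda>w. partial_blaschke a N w * szego z w - blaschke_product a w * szego z w"
  have R: "R holomorphic_on unit_disc" "\<And>w. norm w < 1 \<Longrightarrow> norm (R w) \<le> 1"
    unfolding R_def using blaschke_product_holomorphic norm_blaschke_product_le blaschke_sequence_shift[OF a] by auto
  show hol: "?d holomorphic_on unit_disc"
    by (intro holomorphic_intros partial_blaschke_holomorphic blaschke_product_holomorphic szego_holomorphic a z)
  fix r :: real assume r: "0 < r" "r < 1"
  have bound: "(norm (?d w))\<^sup>2 \<le> (2 - 2 * Re (R w)) / (1 - norm z)\<^sup>2" if w: "norm w < 1" for w
  proof -
    have "?d w = partial_blaschke a N w * ((1 - R w) * szego z w)"
      using blaschke_product_split[OF a w, of N] by (simp add: R_def algebra_simps)
    then have "norm (?d w) = norm (partial_blaschke a N w) * (norm (1 - R w) * norm (szego z w))"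
      by (simp add: norm_mult)
    also have "\<dots> \<le> 1 * (norm (1 - R w) * (1 / (1 - norm z)))"
      using w z by (intro mult_mono norm_partial_blaschke_le a norm_szego_le mult_nonneg_nonneg) auto
    finally have "(norm (?d w))\<^sup>2 \<le> (norm (1 - R w) / (1 - norm z))\<^sup>2"
      by (intro power_mono) auto
    also have "\<dots> = (norm (1 - R w))\<^sup>2 / (1 - norm z)\<^sup>2" by (simp add: power_divide)
    also have "(norm (1 - R w))\<^sup>2 \<le> 2 - 2 * Re (R w)"
    proof -
      have "(norm (R w))\<^sup>2 \<le> 1" using R(2)[OF w] by (simp add: power_le_one)
      then show ?thesis by (simp add: cmod_power2 power2_diff)
    qed
    finally show ?thesis using z by (simp add: divide_right_mono)
  qed
  have Rc: "(\<lambda>t. R (rcis r t)) integrable_on {0..2*pi}"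
    using continuous_on_circle[OF R(1)] r by (intro integrable_continuous_interval) auto
  have "integral {0..2*pi} (\<lambda>t. R (rcis r t)) = complex_of_real (2 * pi) * R 0"
    using tcoeff_integral[OF R(1), of r 0] r by (simp add: tcoeff_def)
  with integrable_integral[OF Rc] have "((\<lambda>t. R (rcis r t)) has_integral complex_of_real (2 * pi) * R 0) {0..2*pi}"
    by simp
  from has_integral_linear[OF this bounded_linear_Re]
  have "((\<lambda>t. Re (R (rcis r t))) has_integral 2 * pi * Re (R 0)) {0..2*pi}"
    by (simp add: o_def)
  from has_integral_mult_left[OF has_integral_diff[OF has_integral_const_real[of 2] has_integral_mult_right[OF this, of 2]], of "1 / (1 - norm z)\<^sup>2"]
  have major: "((\<lambda>t. (2 - 2 * Re (R (rcis r t))) / (1 - norm z)\<^sup>2) has_integral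
      2 * pi * ((2 - 2 * Re (R 0)) / (1 - norm z)\<^sup>2)) {0..2*pi}"
    by (simp add: algebra_simps diff_divide_distrib)
  have "integral {0..2*pi} (\<lambda>t. (norm (?d (rcis r t)))\<^sup>2) \<le> 2 * pi * ((2 - 2 * Re (R 0)) / (1 - norm z)\<^sup>2)"
  proof (rule has_integral_le[OF integrable_integral major])
    show "(\<lambda>t. (norm (?d (rcis r t)))\<^sup>2) integrable_on {0..2*pi}"
      by (rule integrable_continuous_interval, rule continuous_on_power, rule continuous_on_norm,
          rule continuous_on_circle[OF hol]) (use r in auto)
  qed (use bound r in auto)
  then show "integral {0..2*pi} (\<lambda>t. (norm (?d (rcis r t)))\<^sup>2) \<le> 2 * pi * ((2 - 2 * Re (blaschke_product (\<lambda>n. a (n + N)) 0)) / (1 - norm z)\<^sup>2)"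
    by (simp add: R_def)
qed

lemma coeff_inner_diff_right:
  assumes "f \<in> hardy2" "g \<in> hardy2" "h \<in> hardy2"
  shows "coeff_inner f (\<lambda>w. g w - h w) = coeff_inner f g - coeff_inner f h"
    and "(\<lambda>w. g w - h w) \<in> hardy2"
proof -
  have tc: "tcoeff (\<lambda>w. g w - h w) n = tcoeff g n - tcoeff h n" for n
    using tcoeff_add[OF hardy2_holomorphic[OF assms(2)], of "\<lambda>w. (-1) * h w" n]
      tcoeff_cmult[OF hardy2_holomorphic[OF assms(3)], of "-1" n] hardy2_holomorphic[OF assms(3)]
    by (simp add: holomorphic_on_minus)
  show "coeff_inner f (\<lambda>w. g w - h w) = coeff_inner f g - coeff_inner f h"
    using sums_diff[OF coeff_inner_sums[OF assms(1,2)] coeff_inner_sums[OF assms(1,3)]]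
    unfolding coeff_inner_def[of f "\<lambda>w. g w - h w"] tc by (simp add: sums_iff algebra_simps)
  have "summable (\<lambda>n. (norm (tcoeff g n - tcoeff h n))\<^sup>2)"
  proof (rule summable_comparison_test')
    show "summable (\<lambda>n. 2 * (norm (tcoeff g n))\<^sup>2 + 2 * (norm (tcoeff h n))\<^sup>2)"
      by (intro summable_add summable_mult hardy2_summable assms)
    show "norm ((norm (tcoeff g n - tcoeff h n))\<^sup>2) \<le> 2 * (norm (tcoeff g n))\<^sup>2 + 2 * (norm (tcoeff h n))\<^sup>2" for n
    proof -
      have "(norm (tcoeff g n - tcoeff h n))\<^sup>2 \<le> (norm (tcoeff g n) + norm (tcoeff h n))\<^sup>2"
        by (intro power_mono norm_triangle_ineq4) simp
      also have "\<dots> \<le> 2 * (norm (tcoeff g n))\<^sup>2 + 2 * (norm (tcoeff h n))\<^sup>2"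
        using sum_squares_bound[of "norm (tcoeff g n)" "norm (tcoeff h n)"] by (simp add: power2_sum)
      finally show ?thesis by simp
    qed
  qed
  then show "(\<lambda>w. g w - h w) \<in> hardy2"
    using hardy2_holomorphic assms by (simp add: hardy2_iff_square_summable tc holomorphic_on_diff)
qed

text \<open>Write \<open>B\<^sub>N\<close> for the partial product. Pairing \<open>f\<close> with the Takenaka--Malmquist expansion of
  the Szego kernel at \<open>z\<close> splits \<open>f z\<close> into a combination of the first \<open>N\<close> kernels and the term
  \<open>B\<^sub>N(z) h\<^sub>N(z)\<close>, where \<open>h\<^sub>N(z)\<close> is the inner product of \<open>f\<close> with \<open>B\<^sub>N\<close> times the kernel. The
  term vanishes at the first \<open>N\<close> zeros. Since \<open>f\<close> is orthogonal to \<open>B\<close> times the kernel, \<open>B\<^sub>N\<close> may be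
  replaced by \<open>B\<^sub>N - B\<close> in \<open>h\<^sub>N\<close>, which makes it locally uniformly small.\<close>
lemma model_space_approximation:
  assumes a: "blaschke_sequence a" and inj: "inj a" and f: "f \<in> model_space (blaschke_product a)"
  obtains \<gamma> :: "nat \<Rightarrow> nat \<Rightarrow> complex" and \<epsilon> :: "nat \<Rightarrow> real" where
    "\<And>N n. n < N \<Longrightarrow> (\<Sum>k<N. \<gamma> N k * szego (a k) (a n)) = f (a n)"
    "\<And>N z. norm z < 1 \<Longrightarrow> norm (f z - (\<Sum>k<N. \<gamma> N k * szego (a k) z)) \<le> \<epsilon> N / (1 - norm z)"
    "\<epsilon> \<longlonglongrightarrow> 0"
proof -
  let ?B = "partial_blaschke a" let ?\<phi> = "\<lambda>n w. ?B n w * szego (a n) w"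
  have fH: "f \<in> hardy2" using f by (simp add: model_space_def hardy2_orth_def)
  note holf = hardy2_holomorphic[OF fH]
  have BK: "(\<lambda>w. ?B N w * szego z w) \<in> hardy2" if "norm z < 1" for N z
    by (intro bounded_times_szego_hardy2 partial_blaschke_holomorphic norm_partial_blaschke_le a that)
  have BK': "(\<lambda>w. blaschke_product a w * szego z w) \<in> hardy2" if "norm z < 1" for z
    by (intro bounded_times_szego_hardy2 blaschke_product_holomorphic norm_blaschke_product_le a that)
  define h where "h N z = coeff_inner f (\<lambda>w. ?B N w * szego z w)" for N z
  define F where "F N z = (\<Sum>n<N. of_real (1 - (norm (a n))\<^sup>2) * coeff_inner f (?\<phi> n) * ?\<phi> n z)" for N z
  have split: "f z = ?B N z * h N z + F N z" if z: "norm z < 1" for N z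
  proof -
    \<comment> \<open>The remainder kernel is given the index \<open>N\<close>, so that the expansion is one finite sum.\<close>
    let ?I = "insert N {..<N}"
    let ?g = "\<lambda>n. if n = N then (\<lambda>w. ?B N w * szego z w) else ?\<phi> n"
    let ?c = "\<lambda>n. if n = N then cnj (?B N z) else of_real (1 - (norm (a n))\<^sup>2) * cnj (?\<phi> n z)"
    have g: "?g n \<in> hardy2" for n
      using BK[OF z] BK[OF blaschke_sequenceD(2)[OF a]] by simp
    have "szego z w = (\<Sum>n\<in>?I. ?c n * ?g n w)" if "norm w < 1" for w
      using takenaka_kernel_identity[OF a z that, of N] by (simp add: mult.assoc)
    then have "tcoeff (szego z) n = tcoeff (\<lambda>w. \<Sum>n\<in>?I. ?c n * ?g n w) n" for n
      by (intro tcoeff_cong szego_holomorphic z)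
    then have "coeff_inner f (szego z) = coeff_inner f (\<lambda>w. \<Sum>n\<in>?I. ?c n * ?g n w)"
      by (simp only: coeff_inner_def)
    also have "\<dots> = (\<Sum>n\<in>?I. cnj (?c n) * coeff_inner f (?g n))"
      by (rule coeff_inner_sum_right[OF fH g])
    also have "\<dots> = ?B N z * h N z + F N z"
      by (simp add: h_def F_def mult_ac)
    finally show ?thesis by (simp add: coeff_inner_szego[OF holf z])
  qed
  have "F N \<in> kernel_span a {..<N}" for N
    unfolding F_def[abs_def]
    by (rule kernel_span_combination[of _ ?\<phi>]) (simp add: takenaka_in_kernel_span[OF a inj])
  then have "\<forall>N. \<exists>c. \<forall>w\<in>unit_disc. F N w = (\<Sum>k<N. c k * szego (a k) w)"
    unfolding kernel_span_def by blast
  then obtain \<gamma> where "\<forall>N. \<forall>w\<in>unit_disc. F N w = (\<Sum>k<N. \<gamma> N k * szego (a k) w)"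
    by metis
  then have \<gamma>: "(\<Sum>k<N. \<gamma> N k * szego (a k) w) = F N w" if "norm w < 1" for N w
    using that by simp
  \<comment> \<open>\<open>energy f\<close> bounds one factor of Cauchy--Schwarz, the tail at the origin the other.\<close>
  define \<epsilon> where "\<epsilon> N = sqrt (energy f * (2 - 2 * Re (blaschke_product (\<lambda>n. a (n + N)) 0)))" for N
  show ?thesis
  proof (rule that)
    show "(\<Sum>k<N. \<gamma> N k * szego (a k) (a n)) = f (a n)" if "n < N" for N n
      using \<gamma>[of "a n" N] split[of "a n" N] partial_blaschke_zero[OF that, of a] blaschke_sequenceD(2)[OF a, of n]
      by simp
    show "norm (f z - (\<Sum>k<N. \<gamma> N k * szego (a k) z)) \<le> \<epsilon> N / (1 - norm z)" if z: "norm z < 1" for N z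
    proof -
      have "hardy2_inner f (\<lambda>w. blaschke_product a w * szego z w) = 0"
        using f szego_hardy2[OF z] by (auto simp: model_space_def hardy2_orth_def)
      then have "coeff_inner f (\<lambda>w. blaschke_product a w * szego z w) = 0"
        by (simp add: hardy2_inner_eq_coeff_inner fH BK' z)
      then have "h N z = coeff_inner f (\<lambda>w. ?B N w * szego z w - blaschke_product a w * szego z w)"
        using coeff_inner_diff_right(1)[OF fH BK BK', OF z z] by (simp add: h_def)
      then have "norm (h N z) \<le> sqrt (energy f * energy (\<lambda>w. ?B N w * szego z w - blaschke_product a w * szego z w))"
        using coeff_inner_Cauchy_Schwarz[OF fH coeff_inner_diff_right(2)[OF fH BK BK', OF z z]] by simp
      also have "\<dots> \<le> sqrt (energy f * ((2 - 2 * Re (blaschke_product (\<lambda>n. a (n + N)) 0)) / (1 - norm z)\<^sup>2))"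
        by (intro real_sqrt_le_mono mult_left_mono energy_partial_blaschke_error a z energy_nonneg fH)
      also have "\<dots> = \<epsilon> N / (1 - norm z)"
        using z by (simp add: \<epsilon>_def real_sqrt_divide real_sqrt_mult)
      finally have hb: "norm (h N z) \<le> \<epsilon> N / (1 - norm z)" .
      have "f z - (\<Sum>k<N. \<gamma> N k * szego (a k) z) = ?B N z * h N z"
        using \<gamma>[OF z, of N] split[OF z, of N] by simp
      then have "norm (f z - (\<Sum>k<N. \<gamma> N k * szego (a k) z)) = norm (?B N z) * norm (h N z)"
        by (simp add: norm_mult)
      also have "\<dots> \<le> norm (h N z)"
        using norm_partial_blaschke_le[OF a z, of N] by (simp add: mult_left_le_one_le)
      finally show ?thesis using hb by linarith
    qed
    have "\<epsilon> \<longlonglongrightarrow> sqrt (energy f * (2 - 2 * Re 1))"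
      unfolding \<epsilon>_def by (intro tendsto_intros blaschke_tail_at_0 a)
    then show "\<epsilon> \<longlonglongrightarrow> 0" by simp
  qed
qed

section \<open>Interpolation with Jones functions\<close>

text \<open>The discrete form of \<open>\<integral>\<^sub>0\<^sup>\<infinity> exp (- x) dx = 1\<close>: ordering the points by decreasing \<open>f\<close>, the sum is at most
  a lower Riemann sum with steps \<open>t a\<close>. In the induction the element with the largest \<open>f\<close> is added, which
  multiplies all the other terms by \<open>exp (- t x)\<close>.\<close>
lemma telescoping_exponential_sum:
  fixes t :: "'a \<Rightarrow> real" and f :: "'a \<Rightarrow> real"
  assumes "finite A" and t: "\<And>a. t a \<ge> 0"
  shows "(\<Sum>a\<in>A. t a * exp (- (\<Sum>b | b \<in> A \<and> f a \<le> f b. t b))) \<le> 1"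
  using \<open>finite A\<close>
proof (induction A rule: finite_ranking_induct[where f = f])
  case (insert x A)
  show ?case
  proof (cases "x \<in> A")
    case True
    then show ?thesis using insert.IH by (simp add: insert_absorb)
  next
    case False
    have "(\<Sum>b | b \<in> insert x A \<and> f a \<le> f b. t b) = t x + (\<Sum>b | b \<in> A \<and> f a \<le> f b. t b)" if "a \<in> A" for a
    proof -
      have "{b. b \<in> insert x A \<and> f a \<le> f b} = insert x {b. b \<in> A \<and> f a \<le> f b}"
        using insert.hyps(2)[OF that] by auto
      then show ?thesis using insert.hyps(1) False by simp
    qed
    then have "(\<Sum>a\<in>A. t a * exp (- (\<Sum>b | b \<in> insert x A \<and> f a \<le> f b. t b))) =
        exp (- t x) * (\<Sum>a\<in>A. t a * exp (- (\<Sum>b | b \<in> A \<and> f a \<le> f b. t b)))"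
      by (simp add: sum_distrib_left exp_add[symmetric] mult_ac exp_diff exp_minus field_simps)
    also have "\<dots> \<le> exp (- t x) * 1" by (intro mult_left_mono insert.IH) auto
    finally have 1: "(\<Sum>a\<in>A. t a * exp (- (\<Sum>b | b \<in> insert x A \<and> f a \<le> f b. t b))) \<le> exp (- t x)" by simp
    have "t x \<le> (\<Sum>b | b \<in> insert x A \<and> f x \<le> f b. t b)"
      using insert.hyps(1) t by (intro member_le_sum) auto
    then have 2: "t x * exp (- (\<Sum>b | b \<in> insert x A \<and> f x \<le> f b. t b)) \<le> t x * exp (- t x)"
      using t by (intro mult_left_mono) auto
    have "(1 + t x) * exp (- t x) \<le> exp (t x) * exp (- t x)"
      by (intro mult_right_mono exp_ge_add_one_self) auto
    also have "\<dots> = 1" by (simp flip: exp_add)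
    finally show ?thesis using 1 2 False insert.hyps(1) by (simp add: ring_distribs)
  qed
qed simp

text \<open>Up to the factor \<open>1 - (norm a)\<^sup>2\<close>, this is the squared modulus of the normalized Szego kernel at \<open>a\<close>.\<close>
definition carleson_weight :: "complex \<Rightarrow> complex \<Rightarrow> real" where
  "carleson_weight a z = (1 - (norm a)\<^sup>2)\<^sup>2 * (norm (szego a z))\<^sup>2"

text \<open>The analytic completion of a Poisson type kernel; its real part makes the exponential
  in the Jones functions decay.\<close>
definition herglotz :: "complex \<Rightarrow> complex \<Rightarrow> complex" where
  "herglotz a z = (1 + cnj a * z) / (1 - cnj a * z)"

text \<open>P. Jones's explicit interpolating functions. The product vanishes at the other points, the square is the kernel that
  localizes near \<open>a\<close> and is normalized at \<open>a\<close>, and the exponential makes the sum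
  of the moduli over \<open>a\<close> bounded; it runs over the points of modulus at least that of \<open>a\<close>.\<close>
definition jones :: "complex set \<Rightarrow> complex \<Rightarrow> complex \<Rightarrow> complex" where
  "jones A a z = (\<Prod>b\<in>A - {a}. blaschke_factor b z / blaschke_factor b a) *
     (of_real (1 - (norm a)\<^sup>2) * szego a z)\<^sup>2 *
     exp (\<Sum>b | b \<in> A \<and> norm a \<le> norm b. of_real (1 - (norm b)\<^sup>2) * (herglotz b a - herglotz b z))"

lemma Re_herglotz: "Re (herglotz a z) = (1 - (norm a)\<^sup>2 * (norm z)\<^sup>2) * (norm (szego a z))\<^sup>2"
proof -
  let ?s = "cnj a * z"
  have "Re ((1 + s) * cnj (1 - s)) = 1 - (norm s)\<^sup>2" for s
    unfolding cmod_power2 by (simp add: power2_eq_square algebra_simps)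
  moreover have "herglotz a z = (1 + ?s) * cnj (1 - ?s) / of_real ((norm (1 - ?s))\<^sup>2)"
    unfolding herglotz_def by (subst complex_div_cnj) simp
  ultimately have "Re (herglotz a z) = (1 - (norm ?s)\<^sup>2) / (norm (1 - ?s))\<^sup>2"
    by (simp only: Re_divide_of_real)
  then show ?thesis by (simp add: szego_def norm_mult norm_divide power_mult_distrib power_divide)
qed

lemma herglotz_ge_carleson_weight:
  assumes "norm a < 1" "norm z < 1"
  shows "carleson_weight a z \<le> (1 - (norm a)\<^sup>2) * Re (herglotz a z)"
proof -
  have "(norm a)\<^sup>2 * (norm z)\<^sup>2 \<le> (norm a)\<^sup>2" using assms by (simp add: mult_left_le power_le_one)
  moreover have "(norm a)\<^sup>2 \<le> 1" using assms by (simp add: power_le_one)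
  ultimately have "(1 - (norm a)\<^sup>2) * ((1 - (norm a)\<^sup>2) * (norm (szego a z))\<^sup>2) \<le>
      (1 - (norm a)\<^sup>2) * ((1 - (norm a)\<^sup>2 * (norm z)\<^sup>2) * (norm (szego a z))\<^sup>2)"
    by (intro mult_left_mono mult_right_mono) auto
  then show ?thesis by (simp add: Re_herglotz carleson_weight_def power2_eq_square mult.assoc)
qed

text \<open>This is where the restriction to points \<open>b\<close> of larger modulus is used: the numerator
  \<open>1 - (norm b)\<^sup>2 * (norm a)\<^sup>2\<close> is then at most twice \<open>1 - (norm a)\<^sup>2\<close>, which is the numerator of the defect.\<close>
lemma herglotz_le_at_smaller_point:
  assumes "b \<noteq> 0" "norm b < 1" "norm a \<le> norm b"
  shows "(1 - (norm b)\<^sup>2) * Re (herglotz b a) \<le> 2 * (1 - (norm (blaschke_factor b a))\<^sup>2)"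
proof -
  have a: "norm a < 1" using assms by simp
  have "(norm a)\<^sup>2 * (norm a)\<^sup>2 \<le> (norm b)\<^sup>2 * (norm a)\<^sup>2" using assms by (intro mult_right_mono power_mono) auto
  moreover have "(norm a)\<^sup>2 * (norm a)\<^sup>2 \<ge> 2 * (norm a)\<^sup>2 - 1"
    using sum_squares_bound[of "(norm a)\<^sup>2" 1] by (simp add: power2_eq_square)
  ultimately have "1 - (norm b)\<^sup>2 * (norm a)\<^sup>2 \<le> 2 * (1 - (norm a)\<^sup>2)" by simp
  moreover have "(norm b)\<^sup>2 \<le> 1" using assms by (simp add: power_le_one)
  ultimately have "(1 - (norm b)\<^sup>2) * ((1 - (norm b)\<^sup>2 * (norm a)\<^sup>2) * (norm (szego b a))\<^sup>2)
     \<le> (1 - (norm b)\<^sup>2) * ((2 * (1 - (norm a)\<^sup>2)) * (norm (szego b a))\<^sup>2)"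
    by (intro mult_left_mono mult_right_mono) auto
  then show ?thesis
    unfolding one_minus_norm_blaschke_factor[OF assms(1,2) a] Re_herglotz by (simp only: mult_ac)
qed

lemma norm_blaschke_factor_eq_pseudohyperbolic:
  assumes "b \<noteq> 0" shows "norm (blaschke_factor b a) = pseudohyperbolic b a"
proof -
  have "norm (1 - cnj b * a) = norm (1 - cnj a * b)"
    by (metis complex_cnj_cnj complex_cnj_diff complex_cnj_mult complex_cnj_one complex_mod_cnj mult.commute)
  then show ?thesis using assms
    by (simp add: blaschke_factor_def pseudohyperbolic_def norm_mult norm_divide)
qed

text \<open>The constants below depend on the separation \<open>\<delta>\<close> alone, which permits exhausting an infinite
  sequence by finite sets.\<close>
context
  fixes A :: "complex set" and \<delta> :: real
  assumes A: "finite A" "\<And>a. a \<in> A \<Longrightarrow> a \<noteq> 0 \<and> norm a < 1"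
    and \<delta>: "\<delta> > 0" "\<And>a. a \<in> A \<Longrightarrow> \<delta> \<le> (\<Prod>b\<in>A - {a}. pseudohyperbolic b a)"
begin

lemma separation_blaschke:
  assumes "a \<in> A"
  shows "\<delta> \<le> (\<Prod>b\<in>A - {a}. norm (blaschke_factor b a))" "\<And>b. b \<in> A - {a} \<Longrightarrow> blaschke_factor b a \<noteq> 0"
proof -
  have "(\<Prod>b\<in>A - {a}. norm (blaschke_factor b a)) = (\<Prod>b\<in>A - {a}. pseudohyperbolic b a)"
    using A by (intro prod.cong norm_blaschke_factor_eq_pseudohyperbolic) auto
  then show *: "\<delta> \<le> (\<Prod>b\<in>A - {a}. norm (blaschke_factor b a))" using \<delta>(2)[OF assms] by simp
  fix b assume b: "b \<in> A - {a}"
  have "(\<Prod>b\<in>A - {a}. norm (blaschke_factor b a)) \<noteq> 0" using * \<delta>(1) by linarith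
  then show "blaschke_factor b a \<noteq> 0" using b A(1) by (auto simp: prod_zero_iff)
qed

lemma jones_interpolates:
  assumes "a \<in> A" "c \<in> A"
  shows "jones A a c = (if c = a then 1 else 0)"
proof (cases "c = a")
  case True
  have "szego a a = 1 / of_real (1 - (norm a)\<^sup>2)"
    by (simp add: szego_def complex_norm_square mult.commute del: of_real_power)
  moreover have "1 - (norm a)\<^sup>2 \<noteq> 0" using A(2)[OF assms(1)] abs_square_less_1[of "norm a"] by simp
  moreover have "(\<Prod>b\<in>A - {a}. blaschke_factor b a / blaschke_factor b a) = 1"
    using separation_blaschke(2)[OF assms(1)] by (intro prod.neutral) auto
  ultimately show ?thesis unfolding jones_def True by (simp del: of_real_diff)
next
  case False
  have "(\<Prod>b\<in>A - {a}. blaschke_factor b c / blaschke_factor b a) = 0"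
    using assms A(1) False by (intro prod_zero bexI[of _ c]) (auto simp: blaschke_factor_def)
  then show ?thesis using False by (simp add: jones_def)
qed

text \<open>The product over the other points costs \<open>1 / \<delta>\<close>. In the exponential, the part evaluated at \<open>a\<close> is
  controlled by the defects \<open>1 - \<rho>\<^sup>2\<close>, and \<open>exp (1 - \<rho>\<^sup>2) \<le> \<rho>\<^sup>-\<^sup>2\<close> converts their sum into the product
  of the \<open>\<rho>\<close>, which is at least \<open>\<delta>\<close>. The part evaluated at \<open>z\<close> produces the decay.\<close>
lemma norm_jones_le:
  assumes a: "a \<in> A" and z: "norm z < 1"
  shows "norm (jones A a z) \<le> exp 2 / \<delta> ^ 5 *
    (carleson_weight a z * exp (- (\<Sum>b | b \<in> A \<and> norm a \<le> norm b. carleson_weight b z)))"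
proof -
  let ?S = "{b. b \<in> A \<and> norm a \<le> norm b}"
  let ?x = "\<lambda>b. norm (blaschke_factor b a)"
  have a1: "norm a < 1" using A(2)[OF a] by simp
  have x: "0 < ?x b" "?x b \<le> 1" if "b \<in> A - {a}" for b
    using separation_blaschke(2)[OF a that] norm_blaschke_factor_le[of b a] A(2)[of b] a1 that by auto
  define P where "P = (\<Prod>b\<in>A - {a}. ?x b)"
  have P: "\<delta> \<le> P" unfolding P_def by (rule separation_blaschke(1)[OF a])
  have 1: "norm (\<Prod>b\<in>A - {a}. blaschke_factor b z / blaschke_factor b a) \<le> 1 / \<delta>"
  proof -
    have "norm (\<Prod>b\<in>A - {a}. blaschke_factor b z / blaschke_factor b a) = (\<Prod>b\<in>A - {a}. norm (blaschke_factor b z)) / P"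
      by (simp add: P_def norm_divide prod_dividef flip: prod_norm)
    also have "\<dots> \<le> 1 / \<delta>"
      using A z P \<delta> by (intro frac_le prod_le_1) (auto intro!: norm_blaschke_factor_le)
    finally show ?thesis .
  qed
  have 2: "norm ((of_real (1 - (norm a)\<^sup>2) * szego a z)\<^sup>2) = carleson_weight a z"
    by (simp add: carleson_weight_def norm_mult norm_power power_mult_distrib del: of_real_diff)
  have 3: "norm (exp (\<Sum>b\<in>?S. of_real (1 - (norm b)\<^sup>2) * (herglotz b a - herglotz b z)))
    \<le> (exp 2 / \<delta> ^ 4) * exp (- (\<Sum>b\<in>?S. carleson_weight b z))"
  proof -
    have "(\<Sum>b\<in>?S. (1 - (norm b)\<^sup>2) * Re (herglotz b a)) \<le> (\<Sum>b\<in>?S. 2 * (1 - (?x b)\<^sup>2))"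
      using A by (intro sum_mono herglotz_le_at_smaller_point) auto
    also have "\<dots> \<le> (\<Sum>b\<in>A. 2 * (1 - (?x b)\<^sup>2))"
      using A a1 by (intro sum_mono2) (auto intro!: power_le_one norm_blaschke_factor_le)
    also have "\<dots> \<le> 2 + (\<Sum>b\<in>A - {a}. 2 * (1 - (?x b)\<^sup>2))"
      using A(1) a by (simp add: sum.remove[of A a] blaschke_factor_def)
    finally have "exp (\<Sum>b\<in>?S. (1 - (norm b)\<^sup>2) * Re (herglotz b a)) \<le> exp (2 + (\<Sum>b\<in>A - {a}. 2 * (1 - (?x b)\<^sup>2)))"
      by simp
    also have "\<dots> = exp 2 * (\<Prod>b\<in>A - {a}. exp (2 * (1 - (?x b)\<^sup>2)))"
      using A(1) by (simp only: exp_add exp_sum finite_Diff)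
    also have "(\<Prod>b\<in>A - {a}. exp (2 * (1 - (?x b)\<^sup>2))) \<le> (\<Prod>b\<in>A - {a}. 1 / ?x b ^ 4)"
    proof (intro prod_mono conjI)
      fix b assume b: "b \<in> A - {a}"
      have "(?x b)\<^sup>2 * exp (1 - (?x b)\<^sup>2) \<le> exp ((?x b)\<^sup>2 - 1) * exp (1 - (?x b)\<^sup>2)"
        using exp_ge_add_one_self[of "(?x b)\<^sup>2 - 1"] by (intro mult_right_mono) auto
      also have "\<dots> = 1" by (simp flip: exp_add)
      finally have "exp (1 - (?x b)\<^sup>2) \<le> 1 / (?x b)\<^sup>2" using x[OF b] by (simp add: field_simps)
      then have "(exp (1 - (?x b)\<^sup>2))\<^sup>2 \<le> (1 / (?x b)\<^sup>2)\<^sup>2" by (intro power_mono) auto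
      then show "exp (2 * (1 - (?x b)\<^sup>2)) \<le> 1 / ?x b ^ 4"
        unfolding exp_double by (simp add: power_divide)
    qed auto
    also have "\<dots> = 1 / P ^ 4" by (simp add: P_def prod_dividef prod_power_distrib)
    also have "1 / P ^ 4 \<le> 1 / \<delta> ^ 4" using P \<delta>(1) by (intro divide_left_mono power_mono) auto
    finally have *: "exp (\<Sum>b\<in>?S. (1 - (norm b)\<^sup>2) * Re (herglotz b a)) \<le> exp 2 / \<delta> ^ 4" by simp
    have "norm (exp (\<Sum>b\<in>?S. of_real (1 - (norm b)\<^sup>2) * (herglotz b a - herglotz b z))) =
      exp (\<Sum>b\<in>?S. (1 - (norm b)\<^sup>2) * Re (herglotz b a)) * exp (- (\<Sum>b\<in>?S. (1 - (norm b)\<^sup>2) * Re (herglotz b z)))"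
      by (simp add: norm_exp_eq_Re Re_sum sum_subtractf right_diff_distrib del: of_real_diff flip: exp_add)
    also have "\<dots> \<le> (exp 2 / \<delta> ^ 4) * exp (- (\<Sum>b\<in>?S. carleson_weight b z))"
      using A z \<delta>(1) by (intro mult_mono *) (auto intro!: sum_mono herglotz_ge_carleson_weight)
    finally show ?thesis .
  qed
  have "norm (jones A a z) \<le> (1 / \<delta> * carleson_weight a z) * ((exp 2 / \<delta> ^ 4) * exp (- (\<Sum>b\<in>?S. carleson_weight b z)))"
    unfolding jones_def norm_mult[of "_ * _"] norm_mult[of "prod _ _"] 2
    using \<delta>(1) by (intro mult_mono 1 3) (auto simp: carleson_weight_def)
  also have "\<dots> = exp 2 / \<delta> ^ 5 * (carleson_weight a z * exp (- (\<Sum>b\<in>?S. carleson_weight b z)))"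
    by (simp add: field_simps eval_nat_numeral)
  finally show ?thesis .
qed

lemma sum_norm_jones_le:
  assumes z: "norm z < 1"
  shows "(\<Sum>a\<in>A. norm (jones A a z)) \<le> exp 2 / \<delta> ^ 5"
    and "a \<in> A \<Longrightarrow> norm (jones A a z) \<le> exp 2 / \<delta> ^ 5 * carleson_weight a z"
proof -
  have cw: "carleson_weight a z \<ge> 0" for a by (simp add: carleson_weight_def)
  have "(\<Sum>a\<in>A. norm (jones A a z)) \<le> (\<Sum>a\<in>A. exp 2 / \<delta> ^ 5 *
    (carleson_weight a z * exp (- (\<Sum>b | b \<in> A \<and> norm a \<le> norm b. carleson_weight b z))))"
    by (intro sum_mono norm_jones_le z)
  also have "\<dots> \<le> exp 2 / \<delta> ^ 5 * 1"
    unfolding sum_distrib_left[symmetric]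
    using \<delta>(1) by (intro mult_left_mono telescoping_exponential_sum A(1) cw) auto
  finally show "(\<Sum>a\<in>A. norm (jones A a z)) \<le> exp 2 / \<delta> ^ 5" by simp
  assume a: "a \<in> A"
  have "carleson_weight a z * exp (- (\<Sum>b | b \<in> A \<and> norm a \<le> norm b. carleson_weight b z)) \<le> carleson_weight a z * 1"
    using cw by (intro mult_left_mono) (auto intro!: sum_nonneg)
  then have "exp 2 / \<delta> ^ 5 * (carleson_weight a z * exp (- (\<Sum>b | b \<in> A \<and> norm a \<le> norm b. carleson_weight b z)))
    \<le> exp 2 / \<delta> ^ 5 * carleson_weight a z"
    using \<delta>(1) by (intro mult_left_mono) auto
  with norm_jones_le[OF a z] show "norm (jones A a z) \<le> exp 2 / \<delta> ^ 5 * carleson_weight a z" by linarith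
qed

lemma jones_holomorphic:
  assumes "a \<in> A" shows "jones A a holomorphic_on unit_disc"
proof -
  have "herglotz b holomorphic_on unit_disc" if "norm b < 1" for b
    unfolding herglotz_def using one_minus_cnj_mult_bound(2)[of b] that by (intro holomorphic_intros) auto
  then show ?thesis unfolding jones_def[abs_def]
    using A separation_blaschke(2)[OF assms] assms
    by (intro holomorphic_intros blaschke_factor_holomorphic szego_holomorphic holomorphic_on_exp') auto
qed

text \<open>The Jones functions solve the \<open>H\<^sup>2\<close> interpolation problem linearly. By Cauchy--Schwarz with weights
  \<open>norm (jones A a z)\<close>, whose sum is bounded, \<open>(norm (G z))\<^sup>2\<close> is dominated by a weighted sum of squared Szego kernels,
  and these have explicit norms. The bound depends on \<open>\<delta>\<close> but not on the number of points.\<close>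
lemma hardy_interpolation:
  fixes \<beta> :: "complex \<Rightarrow> complex"
  defines "G \<equiv> \<lambda>z. \<Sum>a\<in>A. \<beta> a * jones A a z"
  shows "G \<in> hardy2" and "\<And>a. a \<in> A \<Longrightarrow> G a = \<beta> a"
    and "energy G \<le> (exp 2 / \<delta> ^ 5)\<^sup>2 * (\<Sum>a\<in>A. (norm (\<beta> a))\<^sup>2 * (1 - (norm a)\<^sup>2))"
proof -
  define K where "K = exp 2 / \<delta> ^ 5"
  have K: "K \<ge> 0" using \<delta>(1) by (simp add: K_def)
  have hol: "G holomorphic_on unit_disc" unfolding G_def
    by (intro holomorphic_intros jones_holomorphic)
  show "G a = \<beta> a" if "a \<in> A" for a
    unfolding G_def using that A(1) by (simp add: jones_interpolates if_distrib cong: if_cong)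
  have pw: "(norm (G z))\<^sup>2 \<le> K\<^sup>2 * (\<Sum>a\<in>A. (norm (\<beta> a))\<^sup>2 * carleson_weight a z)" if z: "norm z < 1" for z
  proof -
    have root: "sqrt (norm w) * (sqrt (norm w) * s) = norm w * s" for w :: complex and s
      by (simp flip: mult.assoc)
    have "norm (G z) \<le> (\<Sum>a\<in>A. sqrt (norm (jones A a z)) * (sqrt (norm (jones A a z)) * norm (\<beta> a)))"
      unfolding G_def unfolding root by (rule order_trans[OF norm_sum]) (simp add: norm_mult mult.commute)
    then have "(norm (G z))\<^sup>2 \<le> (\<Sum>a\<in>A. sqrt (norm (jones A a z)) * (sqrt (norm (jones A a z)) * norm (\<beta> a)))\<^sup>2"
      by (intro power_mono) auto
    also have "\<dots> \<le> (\<Sum>a\<in>A. (sqrt (norm (jones A a z)))\<^sup>2) * (\<Sum>a\<in>A. (sqrt (norm (jones A a z)) * norm (\<beta> a))\<^sup>2)"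
      by (rule Cauchy_Schwarz_ineq_sum)
    also have "\<dots> = (\<Sum>a\<in>A. norm (jones A a z)) * (\<Sum>a\<in>A. norm (jones A a z) * (norm (\<beta> a))\<^sup>2)"
      by (simp add: power_mult_distrib)
    also have "\<dots> \<le> K * (\<Sum>a\<in>A. (K * carleson_weight a z) * (norm (\<beta> a))\<^sup>2)"
      using K sum_norm_jones_le[OF z] unfolding K_def
      by (intro mult_mono sum_mono mult_right_mono) (auto intro!: sum_nonneg)
    also have "\<dots> = K\<^sup>2 * (\<Sum>a\<in>A. (norm (\<beta> a))\<^sup>2 * carleson_weight a z)"
      by (simp add: sum_distrib_left power2_eq_square mult_ac)
    finally show ?thesis .
  qed
  have mean: "integral {0..2*pi} (\<lambda>t. (norm (G (rcis r t)))\<^sup>2) \<le> 2 * pi * (K\<^sup>2 * (\<Sum>a\<in>A. (norm (\<beta> a))\<^sup>2 * (1 - (norm a)\<^sup>2)))"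
    if r: "0 < r" "r < 1" for r
  proof -
    have cont: "continuous_on {0..2*pi} (\<lambda>t. (norm (f (rcis r t)))\<^sup>2)" if "f holomorphic_on unit_disc" for f
      using continuous_on_circle[OF that] r by (intro continuous_intros) auto
    note int = integrable_continuous_interval[OF cont]
    have s: "(\<lambda>t. (norm (szego a (rcis r t)))\<^sup>2) integrable_on {0..2*pi}" if "a \<in> A" for a
      using int[OF szego_holomorphic] A(2)[OF that] by blast
    have "integral {0..2*pi} (\<lambda>t. (norm (G (rcis r t)))\<^sup>2) \<le>
      integral {0..2*pi} (\<lambda>t. \<Sum>a\<in>A. K\<^sup>2 * (norm (\<beta> a))\<^sup>2 * (1 - (norm a)\<^sup>2)\<^sup>2 * (norm (szego a (rcis r t)))\<^sup>2)"
    proof (rule integral_le[OF int[OF hol]])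
      show "(\<lambda>t. \<Sum>a\<in>A. K\<^sup>2 * (norm (\<beta> a))\<^sup>2 * (1 - (norm a)\<^sup>2)\<^sup>2 * (norm (szego a (rcis r t)))\<^sup>2) integrable_on {0..2*pi}"
        by (intro integrable_sum A(1) integrable_on_mult_right s)
      show "(norm (G (rcis r t)))\<^sup>2 \<le> (\<Sum>a\<in>A. K\<^sup>2 * (norm (\<beta> a))\<^sup>2 * (1 - (norm a)\<^sup>2)\<^sup>2 * (norm (szego a (rcis r t)))\<^sup>2)" for t
        using pw[of "rcis r t"] r by (simp add: carleson_weight_def sum_distrib_left mult_ac)
    qed
    also have "\<dots> = (\<Sum>a\<in>A. K\<^sup>2 * (norm (\<beta> a))\<^sup>2 * (1 - (norm a)\<^sup>2)\<^sup>2 * integral {0..2*pi} (\<lambda>t. (norm (szego a (rcis r t)))\<^sup>2))"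
      by (subst integral_sum[OF A(1)]) (auto intro!: integrable_on_mult_right s)
    also have "\<dots> \<le> (\<Sum>a\<in>A. K\<^sup>2 * (norm (\<beta> a))\<^sup>2 * (1 - (norm a)\<^sup>2)\<^sup>2 * (2 * pi * (1 / (1 - (norm a)\<^sup>2))))"
    proof (intro sum_mono mult_left_mono)
      fix a assume "a \<in> A"
      then have "norm a < 1" using A by auto
      then show "integral {0..2*pi} (\<lambda>t. (norm (szego a (rcis r t)))\<^sup>2) \<le> 2 * pi * (1 / (1 - (norm a)\<^sup>2))"
        using circle_integral_le_energy[OF szego_holomorphic hardy2_summable[OF szego_hardy2] r] energy_szego by simp
    qed auto
    also have "\<dots> = (\<Sum>a\<in>A. 2 * pi * (K\<^sup>2 * ((norm (\<beta> a))\<^sup>2 * (1 - (norm a)\<^sup>2))))"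
    proof (rule sum.cong[OF refl])
      fix a assume "a \<in> A"
      then have "1 - (norm a)\<^sup>2 \<noteq> 0" using A(2) abs_square_less_1[of "norm a"] by force
      then show "K\<^sup>2 * (norm (\<beta> a))\<^sup>2 * (1 - (norm a)\<^sup>2)\<^sup>2 * (2 * pi * (1 / (1 - (norm a)\<^sup>2))) =
          2 * pi * (K\<^sup>2 * ((norm (\<beta> a))\<^sup>2 * (1 - (norm a)\<^sup>2)))"
        by (simp add: power2_eq_square[of "1 - (norm a)\<^sup>2"])
    qed
    finally show ?thesis by (simp add: sum_distrib_left)
  qed
  show "G \<in> hardy2"
    using square_summable_of_mean_bound(1)[OF hol mean] hol by (simp add: hardy2_iff_square_summable)
  show "energy G \<le> (exp 2 / \<delta> ^ 5)\<^sup>2 * (\<Sum>a\<in>A. (norm (\<beta> a))\<^sup>2 * (1 - (norm a)\<^sup>2))"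
    using square_summable_of_mean_bound(2)[OF hol mean] by (simp add: K_def)
qed

end

section \<open>Coefficients of kernel sums\<close>

text \<open>All factors are at most one, so each finite product dominates the infinite one. The positive
  bound also forces the points to be distinct.\<close>
lemma uniformly_separated_finite_products:
  assumes a: "blaschke_sequence a" and "uniformly_separated a"
  obtains \<delta> where "\<delta> > 0" "inj a"
    "\<And>N n. \<delta> \<le> (\<Prod>m\<in>{..<N} - {n}. pseudohyperbolic (a m) (a n))"
proof -
  obtain \<delta> where \<delta>: "\<delta> > 0" "\<And>n. \<exists>P\<ge>\<delta>. (\<lambda>m. if m = n then 1 else pseudohyperbolic (a m) (a n)) has_prod P"
    using assms(2) unfolding uniformly_separated_def by blast
  have le1: "pseudohyperbolic (a m) (a n) \<le> 1" for m n
    using norm_blaschke_factor_le[of "a m" "a n"] blaschke_sequenceD[OF a]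
    by (simp add: norm_blaschke_factor_eq_pseudohyperbolic)
  have prod: "\<delta> \<le> (\<Prod>m\<in>{..<N} - {n}. pseudohyperbolic (a m) (a n))" for N n
  proof -
    let ?f = "\<lambda>m. if m = n then 1 else pseudohyperbolic (a m) (a n)"
    obtain P where P: "P \<ge> \<delta>" "?f has_prod P" using \<delta>(2) by blast
    have "P \<le> prod ?f {..<N}"
      using prod_ge_prodinf[OF P(2), of N] has_prod_unique[OF P(2)] le1 by (auto simp: pseudohyperbolic_def)
    also have "prod ?f {..<N} = (\<Prod>m\<in>{..<N} - {n}. pseudohyperbolic (a m) (a n))"
      by (rule prod.mono_neutral_cong_right) auto
    finally show ?thesis using P(1) by linarith
  qed
  have "inj a"
  proof (rule injI, rule ccontr)
    fix m n assume mn: "a m = a n" "m \<noteq> n"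
    then have "(\<Prod>m\<in>{..<Suc m} - {n}. pseudohyperbolic (a m) (a n)) = 0"
      by (intro prod_zero bexI[of _ m]) (auto simp: pseudohyperbolic_def)
    with prod[where N = "Suc m" and n = n] \<delta>(1) show False by simp
  qed
  with that \<delta>(1) prod show ?thesis by blast
qed

lemma kernel_sum_hardy2:
  assumes "\<And>k. k < N \<Longrightarrow> norm (a k) < 1"
  shows "(\<lambda>z. \<Sum>k<N. \<gamma> k * szego (a k) z) \<in> hardy2"
proof (rule hardy2_bounded)
  show "(\<lambda>z. \<Sum>k<N. \<gamma> k * szego (a k) z) holomorphic_on unit_disc"
    using assms by (intro holomorphic_intros szego_holomorphic) auto
  fix z :: complex assume "norm z < 1"
  then show "norm (\<Sum>k<N. \<gamma> k * szego (a k) z) \<le> (\<Sum>k<N. norm (\<gamma> k) * (1 / (1 - norm (a k))))"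
    using assms
    by (intro order_trans[OF norm_sum] sum_mono, unfold norm_mult, intro mult_left_mono norm_szego_le) auto
qed

lemma coeff_inner_kernel_sum:
  assumes "\<And>k. k < N \<Longrightarrow> norm (a k) < 1" "g \<in> hardy2"
  shows "coeff_inner (\<lambda>z. \<Sum>k<N. \<gamma> k * szego (a k) z) g = (\<Sum>k<N. \<gamma> k * cnj (g (a k)))"
  using assms by (subst coeff_inner_sum_left)
    (auto intro!: sum.cong szego_hardy2 simp: szego_coeff_inner hardy2_holomorphic)

lemma coeff_inner_self: "coeff_inner f f = of_real (energy f)" if "f \<in> hardy2"
proof -
  have "(\<lambda>n. complex_of_real ((norm (tcoeff f n))\<^sup>2)) sums of_real (energy f)"
    unfolding energy_def by (intro sums_of_real summable_sums hardy2_summable that)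
  then show ?thesis unfolding coeff_inner_def by (simp add: sums_iff complex_norm_square del: of_real_power)
qed

text \<open>A combination of kernels that interpolates \<open>f\<close> at their points is the orthogonal projection of
  \<open>f\<close> onto their span.\<close>
lemma energy_kernel_sum_le:
  assumes a: "\<And>k. k < N \<Longrightarrow> norm (a k) < 1" and f: "f \<in> hardy2"
    and interp: "\<And>n. n < N \<Longrightarrow> (\<Sum>k<N. \<gamma> k * szego (a k) (a n)) = f (a n)"
  shows "energy (\<lambda>z. \<Sum>k<N. \<gamma> k * szego (a k) z) \<le> energy f"
proof -
  define F where "F = (\<lambda>z. \<Sum>k<N. \<gamma> k * szego (a k) z)"
  have F: "F \<in> hardy2" unfolding F_def using a by (rule kernel_sum_hardy2)
  have "coeff_inner F F = coeff_inner F f"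
    using coeff_inner_kernel_sum[OF a F, where \<gamma> = \<gamma>] coeff_inner_kernel_sum[OF a f, where \<gamma> = \<gamma>] interp
    unfolding F_def by simp
  then have "energy F = norm (coeff_inner F f)"
    using coeff_inner_self[OF F] energy_nonneg[OF F] by (metis norm_of_real abs_of_nonneg)
  also have "\<dots> \<le> sqrt (energy F * energy f)" by (rule coeff_inner_Cauchy_Schwarz[OF F f])
  finally have "(energy F)\<^sup>2 \<le> energy F * energy f"
    using power_mono[of "energy F" "sqrt (energy F * energy f)" 2] energy_nonneg[OF F] energy_nonneg[OF f] by simp
  then show ?thesis unfolding F_def[symmetric]
    using energy_nonneg[OF F] energy_nonneg[OF f] by (cases "energy F = 0") (auto simp: power2_eq_square)
qed

text \<open>Duality: pairing the kernel sum with an \<open>H\<^sup>2\<close> function \<open>G\<close> that has the values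
  \<open>\<gamma> k / (1 - (norm (a k))\<^sup>2)\<close> at the points yields exactly the sum on the left, while the interpolation bound
  estimates the norm of \<open>G\<close> by that same sum. Thus normalized kernels at separated points
  satisfy the lower Riesz bound.\<close>
lemma kernel_coefficients_le:
  assumes a: "blaschke_sequence a" and inj: "inj a" and \<delta>: "\<delta> > 0"
    "\<And>n. \<delta> \<le> (\<Prod>m\<in>{..<N} - {n}. pseudohyperbolic (a m) (a n))"
  shows "(\<Sum>k<N. (norm (\<gamma> k))\<^sup>2 / (1 - (norm (a k))\<^sup>2)) \<le>
    (exp 2 / \<delta> ^ 5)\<^sup>2 * energy (\<lambda>z. \<Sum>k<N. \<gamma> k * szego (a k) z)"
proof -
  define F where "F = (\<lambda>z. \<Sum>k<N. \<gamma> k * szego (a k) z)"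
  define K where "K = exp 2 / \<delta> ^ 5"
  define Q where "Q = (\<Sum>k<N. (norm (\<gamma> k))\<^sup>2 / (1 - (norm (a k))\<^sup>2))"
  \<comment> \<open>Interpolation data are attached to points instead of indices, which injectivity permits.\<close>
  define \<beta> where "\<beta> b = (let k = inv a b in \<gamma> k / of_real (1 - (norm b)\<^sup>2))" for b
  note aD = blaschke_sequenceD[OF a]
  have F: "F \<in> hardy2" unfolding F_def using aD(2) by (rule kernel_sum_hardy2)
  have wpos: "1 - (norm (a k))\<^sup>2 > 0" for k using aD(2)[of k] abs_square_less_1[of "norm (a k)"] by simp
  have \<beta>: "\<beta> (a k) = \<gamma> k / of_real (1 - (norm (a k))\<^sup>2)" for k
    using inj by (simp add: \<beta>_def)
  let ?A = "a ` {..<N}"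
  have A: "finite ?A" "b \<noteq> 0 \<and> norm b < 1" if "b \<in> ?A" for b using aD that by auto
  have sep: "\<delta> \<le> (\<Prod>c\<in>?A - {b}. pseudohyperbolic c b)" if b: "b \<in> ?A" for b
  proof -
    obtain n where n: "b = a n" using b by blast
    have "?A - {b} = a ` ({..<N} - {n})" using inj by (auto simp: n dest: injD)
    then show ?thesis using \<delta>(2)[of n] inj by (simp add: n prod.reindex inj_on_subset)
  qed
  define G where "G = (\<lambda>z. \<Sum>b\<in>?A. \<beta> b * jones ?A b z)"
  have G: "G \<in> hardy2" "\<And>b. b \<in> ?A \<Longrightarrow> G b = \<beta> b"
    "energy G \<le> K\<^sup>2 * (\<Sum>b\<in>?A. (norm (\<beta> b))\<^sup>2 * (1 - (norm b)\<^sup>2))"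
    unfolding G_def K_def using hardy_interpolation[where A = ?A and \<delta> = \<delta> and \<beta> = \<beta>] A \<delta>(1) sep by auto
  have "(\<Sum>b\<in>?A. (norm (\<beta> b))\<^sup>2 * (1 - (norm b)\<^sup>2)) = (\<Sum>k<N. (norm (\<beta> (a k)))\<^sup>2 * (1 - (norm (a k))\<^sup>2))"
    using inj_on_subset[OF inj subset_UNIV] by (subst sum.reindex) (simp_all add: o_def)
  also have "\<dots> = Q"
    unfolding Q_def
  proof (rule sum.cong[OF refl])
    fix k
    have "norm (\<beta> (a k)) = norm (\<gamma> k) / (1 - (norm (a k))\<^sup>2)"
      unfolding \<beta> norm_divide norm_of_real using wpos[of k] by simp
    then show "(norm (\<beta> (a k)))\<^sup>2 * (1 - (norm (a k))\<^sup>2) = (norm (\<gamma> k))\<^sup>2 / (1 - (norm (a k))\<^sup>2)"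
      using wpos[of k] by (simp add: power_divide power2_eq_square[of "1 - _"])
  qed
  finally have EG: "energy G \<le> K\<^sup>2 * Q" using G(3) by (simp only:)
  have Q0: "Q \<ge> 0" unfolding Q_def using wpos by (intro sum_nonneg divide_nonneg_nonneg) (auto simp: less_imp_le)
  have "coeff_inner F G = (\<Sum>k<N. \<gamma> k * cnj (G (a k)))"
    unfolding F_def using aD(2) G(1) by (rule coeff_inner_kernel_sum)
  also have "\<dots> = of_real Q"
    unfolding Q_def of_real_sum using G(2) \<beta>
    by (intro sum.cong refl) (simp add: complex_norm_square del: of_real_diff of_real_power)
  finally have "Q = norm (coeff_inner F G)" using Q0 by simp
  also have "\<dots> \<le> sqrt (energy F * energy G)" by (rule coeff_inner_Cauchy_Schwarz[OF F G(1)])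
  also have "\<dots> \<le> sqrt (energy F * (K\<^sup>2 * Q))"
    by (intro real_sqrt_le_mono mult_left_mono EG energy_nonneg F)
  finally have "Q\<^sup>2 \<le> energy F * (K\<^sup>2 * Q)"
    using power_mono[of Q "sqrt (energy F * (K\<^sup>2 * Q))" 2] Q0 energy_nonneg[OF F] by simp
  then have "Q * Q \<le> (K\<^sup>2 * energy F) * Q" by (simp add: power2_eq_square mult_ac)
  then show ?thesis unfolding F_def[symmetric] K_def[symmetric] Q_def[symmetric]
    using Q0 energy_nonneg[OF F] by (cases "Q = 0") auto
qed

section \<open>An area integral\<close>

text \<open>Let \<open>x\<close> be the distance to \<open>c\<close>. On \<open>[0, d]\<close> the second factor is comparable to \<open>d powr (-q)\<close>, beyond \<open>d\<close> it is
  dominated by \<open>x powr (-q)\<close>; both pieces scale like \<open>d powr (1 + \<alpha> - q)\<close>.\<close>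
lemma nn_integral_shifted_power:
  fixes \<alpha> q d c :: real
  assumes \<alpha>: "-1 < \<alpha>" and q: "1 + \<alpha> < q" and d: "0 < d"
  shows "(\<integral>\<^sup>+x. ennreal (\<bar>x - c\<bar> powr \<alpha> * (d + \<bar>x - c\<bar>) powr (-q)) \<partial>lborel)
    \<le> ennreal (2 * (1 / (1 + \<alpha>) + 1 / (q - 1 - \<alpha>)) * d powr (1 + \<alpha> - q))"
proof -
  let ?g = "\<lambda>x::real. ennreal (\<bar>x\<bar> powr \<alpha> * (d + \<bar>x\<bar>) powr (-q))"
  let ?K = "(1 / (1 + \<alpha>) + 1 / (q - 1 - \<alpha>)) * d powr (1 + \<alpha> - q)"
  have half: "(\<integral>\<^sup>+x. ?g x * indicator {0..} x \<partial>lborel) \<le> ennreal ?K"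
  proof -
    have "(\<integral>\<^sup>+x. ?g x * indicator {0..} x \<partial>lborel) \<le>
      (\<integral>\<^sup>+x. (ennreal (x powr \<alpha>) * indicator {0..d} x) * ennreal (d powr (-q))
        + ennreal (x powr (\<alpha> - q)) * indicator {d..} x \<partial>lborel)"
    proof (rule nn_integral_mono)
      fix x :: real
      have 1: "x powr \<alpha> * (d + x) powr (-q) \<le> x powr \<alpha> * d powr (-q)" if "0 \<le> x"
        using that q \<alpha> d by (intro mult_left_mono powr_mono2') auto
      have 2: "x powr \<alpha> * (d + x) powr (-q) \<le> x powr (\<alpha> - q)" if "d \<le> x"
      proof -
        have "x powr \<alpha> * (d + x) powr (-q) \<le> x powr \<alpha> * x powr (-q)"
          using that q \<alpha> d by (intro mult_left_mono powr_mono2') auto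
        then show ?thesis by (simp add: powr_diff powr_minus field_simps)
      qed
      consider "x < 0" | "0 \<le> x" "x \<le> d" | "d < x" by linarith
      then show "?g x * indicator {0..} x \<le> (ennreal (x powr \<alpha>) * indicator {0..d} x) * ennreal (d powr (-q))
        + ennreal (x powr (\<alpha> - q)) * indicator {d..} x"
      proof cases
        case 2
        then show ?thesis using 1
          by (auto simp: indicator_def simp flip: ennreal_mult intro!: add_increasing2 ennreal_leI)
      next
        case 3
        then show ?thesis using \<open>d \<le> x \<Longrightarrow> _\<close> d
          by (auto simp: indicator_def intro!: ennreal_leI)
      qed auto
    qed
    also have "\<dots> = ennreal (d powr (\<alpha> + 1) / (\<alpha> + 1)) * ennreal (d powr (-q)) + ennreal (- (d powr (\<alpha> - q + 1)) / (\<alpha> - q + 1))"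
      using assms
      by (subst nn_integral_add, simp, simp, subst nn_integral_multc, simp,
          subst nn_integral_has_integral_lebesgue'[OF _ has_integral_powr_from_0], simp, simp, simp,
          subst nn_integral_has_integral_lebesgue'[OF _ has_integral_powr_to_inf]) auto
    also have "\<dots> = ennreal (d powr (\<alpha> + 1) / (\<alpha> + 1) * d powr (-q) + d powr (\<alpha> - q + 1) / (q - 1 - \<alpha>))"
    proof -
      have "- (d powr (\<alpha> - q + 1)) / (\<alpha> - q + 1) = d powr (\<alpha> - q + 1) / (q - 1 - \<alpha>)"
        using minus_divide_divide[of "d powr (\<alpha> - q + 1)" "q - 1 - \<alpha>"] by (simp add: algebra_simps)
      then show ?thesis using assms by (simp flip: ennreal_mult ennreal_plus)
    qed
    also have "d powr (\<alpha> + 1) / (\<alpha> + 1) * d powr (-q) + d powr (\<alpha> - q + 1) / (q - 1 - \<alpha>) = ?K"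
    proof -
      have "d powr (\<alpha> + 1) * d powr (-q) = d powr (1 + \<alpha> - q)" by (simp add: add.commute flip: powr_add)
      then have "d powr (\<alpha> + 1) / (\<alpha> + 1) * d powr (-q) = d powr (1 + \<alpha> - q) / (\<alpha> + 1)"
        by (simp only: times_divide_eq_left)
      moreover have "d powr (\<alpha> - q + 1) = d powr (1 + \<alpha> - q)" by (simp add: algebra_simps)
      ultimately show ?thesis by (simp add: add.commute ring_distribs)
    qed
    finally show ?thesis .
  qed
  have "(\<integral>\<^sup>+x. ?g (x - c) \<partial>lborel) = (\<integral>\<^sup>+x. ?g x \<partial>lborel)"
    using nn_integral_real_affine[of ?g 1 "-c"] by simp
  also have "\<dots> \<le> (\<integral>\<^sup>+x. ?g x * indicator {0..} x + ?g (-x) * indicator {0..} (-x) \<partial>lborel)"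
    by (rule nn_integral_mono) (auto simp: indicator_def)
  also have "\<dots> = (\<integral>\<^sup>+x. ?g x * indicator {0..} x \<partial>lborel) + (\<integral>\<^sup>+x. ?g (-x) * indicator {0..} (-x) \<partial>lborel)"
    by (rule nn_integral_add) auto
  also have "(\<integral>\<^sup>+x. ?g (-x) * indicator {0..} (-x) \<partial>lborel) = (\<integral>\<^sup>+x. ?g x * indicator {0..} x \<partial>lborel)"
    using nn_integral_real_affine[of "\<lambda>x. ?g x * indicator {0..} x" "-1" 0] by simp
  also have "(\<integral>\<^sup>+x. ?g x * indicator {0..} x \<partial>lborel) + (\<integral>\<^sup>+x. ?g x * indicator {0..} x \<partial>lborel) \<le> ennreal ?K + ennreal ?K"
    by (intro add_mono half)
  also have "\<dots> = ennreal (2 * ?K)"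
    using assms by (subst ennreal_plus[symmetric]) auto
  finally show ?thesis by (simp only: mult.assoc)
qed

lemma measurable_Complex: "(\<lambda>(x, y). Complex x y) \<in> borel_measurable (lborel \<Otimes>\<^sub>M lborel)"
proof -
  have "(\<lambda>(x, y). Complex x y) \<in> borel_measurable borel"
    by (intro borel_measurable_continuous_onI) (auto simp: Complex_eq case_prod_beta intro!: continuous_intros)
  then show ?thesis by (simp add: lborel_prod)
qed

lemma lborel_complex: "(lborel :: complex measure) = distr (lborel \<Otimes>\<^sub>M lborel) borel (\<lambda>(x, y). Complex x y)"
proof (rule lborel_eqI)
  have meas: "(\<lambda>(x, y). Complex x y) \<in> borel_measurable (lborel \<Otimes>\<^sub>M lborel)"
    by (rule measurable_Complex)
  fix l u :: complex assume lu: "\<And>b. b \<in> Basis \<Longrightarrow> l \<bullet> b \<le> u \<bullet> b"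
  have "(\<lambda>(x, y). Complex x y) -` box l u = {Re l<..<Re u} \<times> {Im l<..<Im u}"
    by (auto simp: in_box_complex_iff)
  then show "emeasure (distr (lborel \<Otimes>\<^sub>M lborel) borel (\<lambda>(x, y). Complex x y)) (box l u) = ennreal (\<Prod>b\<in>Basis. (u - l) \<bullet> b)"
    using lu[of 1] lu[of \<i>] meas
    by (subst emeasure_distr) (auto simp: Basis_complex_def space_pair_measure lborel.emeasure_pair_measure_Times ennreal_mult)
qed simp

lemma nn_integral_complex:
  assumes f [measurable]: "f \<in> borel_measurable borel"
  shows "(\<integral>\<^sup>+z. f z \<partial>lborel) = (\<integral>\<^sup>+x. \<integral>\<^sup>+y. f (Complex x y) \<partial>lborel \<partial>lborel)"
proof -
  have meas [measurable]: "(\<lambda>(x, y). Complex x y) \<in> borel_measurable (lborel \<Otimes>\<^sub>M lborel)"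
    by (rule measurable_Complex)
  have "(\<integral>\<^sup>+z. f z \<partial>lborel) = (\<integral>\<^sup>+p. f (case p of (x, y) \<Rightarrow> Complex x y) \<partial>(lborel \<Otimes>\<^sub>M lborel))"
    by (subst lborel_complex) (rule nn_integral_distr, auto)
  also have "\<dots> = (\<integral>\<^sup>+x. \<integral>\<^sup>+y. f (Complex x y) \<partial>lborel \<partial>lborel)"
    by (subst lborel.nn_integral_fst[symmetric]) auto
  finally show ?thesis .
qed

text \<open>When the two factors are centred at different points, at each \<open>x\<close> the product only grows if the centre
  that is farther away is moved to the nearer one, because both factors decrease with the distance. Thus the product
  is dominated by a sum of products with a common centre.\<close>
lemma nn_integral_two_centres:
  fixes \<alpha> q d c X :: real
  assumes \<alpha>: "-1 < \<alpha>" "\<alpha> \<le> 0" and q: "1 + \<alpha> < q" and d: "0 < d"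
  defines "J \<equiv> 2 * (1 / (1 + \<alpha>) + 1 / (q - 1 - \<alpha>)) * d powr (1 + \<alpha> - q)"
  shows "(\<integral>\<^sup>+x. ennreal ((if \<bar>x\<bar> < X then (X - \<bar>x\<bar>) powr \<alpha> else 0) * (d + \<bar>x - c\<bar>) powr (-q)) \<partial>lborel) \<le> ennreal (3 * J)"
proof -
  define G where "G s x = \<bar>x - s\<bar> powr \<alpha> * (d + \<bar>x - s\<bar>) powr (-q)" for s x :: real
  have [measurable]: "G s \<in> borel_measurable borel" for s unfolding G_def[abs_def] by measurable
  have G: "(\<integral>\<^sup>+x. ennreal (G s x) \<partial>lborel) \<le> ennreal J" for s
    unfolding G_def J_def by (rule nn_integral_shifted_power) (use assms in auto)
  have G0: "G s x \<ge> 0" for s x by (simp add: G_def)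
  have J0: "J \<ge> 0" using assms by (simp add: J_def)
  have "(\<integral>\<^sup>+x. ennreal ((if \<bar>x\<bar> < X then (X - \<bar>x\<bar>) powr \<alpha> else 0) * (d + \<bar>x - c\<bar>) powr (-q)) \<partial>lborel)
    \<le> (\<integral>\<^sup>+x. ennreal (G X x) + (ennreal (G (-X) x) + ennreal (G c x)) \<partial>lborel)"
  proof (rule nn_integral_mono_AE)
    \<comment> \<open>At \<open>x = c\<close> the convention \<open>0 powr \<alpha> = 0\<close> would spoil the comparison.\<close>
    have "AE x in lborel. x \<noteq> c" by (rule AE_lborel_singleton)
    then show "AE x in lborel. ennreal ((if \<bar>x\<bar> < X then (X - \<bar>x\<bar>) powr \<alpha> else 0) * (d + \<bar>x - c\<bar>) powr (-q))
      \<le> ennreal (G X x) + (ennreal (G (-X) x) + ennreal (G c x))"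
    proof eventually_elim
      case (elim x)
      have "(X - \<bar>x\<bar>) powr \<alpha> * (d + \<bar>x - c\<bar>) powr (-q) \<le> G X x + (G (-X) x + G c x)" if x: "\<bar>x\<bar> < X"
      proof -
        define s where "s = (if x \<ge> 0 then X else - X)"
        have s: "\<bar>x - s\<bar> = X - \<bar>x\<bar>" using x by (auto simp: s_def)
        have "(X - \<bar>x\<bar>) powr \<alpha> * (d + \<bar>x - c\<bar>) powr (-q) \<le> max (G s x) (G c x)"
        proof (cases "X - \<bar>x\<bar> \<le> \<bar>x - c\<bar>")
          case True
          then have "(d + \<bar>x - c\<bar>) powr (-q) \<le> (d + \<bar>x - s\<bar>) powr (-q)"
            using d q \<alpha> s by (intro powr_mono2') auto
          then show ?thesis unfolding G_def s by (intro max.coboundedI1 mult_left_mono) auto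
        next
          case False
          then have "(X - \<bar>x\<bar>) powr \<alpha> \<le> \<bar>x - c\<bar> powr \<alpha>"
            using elim \<alpha> by (intro powr_mono2') auto
          then show ?thesis unfolding G_def by (intro max.coboundedI2 mult_right_mono) auto
        qed
        also have "\<dots> \<le> G X x + (G (-X) x + G c x)"
          using G0[of X x] G0[of "-X" x] G0[of c x] by (auto simp: s_def)
        finally show ?thesis .
      qed
      then show ?case using G0 by (auto simp flip: ennreal_plus intro!: ennreal_leI)
    qed
  qed
  also have "\<dots> = (\<integral>\<^sup>+x. ennreal (G X x) \<partial>lborel) + ((\<integral>\<^sup>+x. ennreal (G (-X) x) \<partial>lborel) + (\<integral>\<^sup>+x. ennreal (G c x) \<partial>lborel))"
    by (subst nn_integral_add; simp)+
  also have "\<dots> \<le> ennreal J + (ennreal J + ennreal J)" by (intro add_mono G)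
  also have "\<dots> = ennreal (3 * J)" using J0 by (simp flip: ennreal_plus)
  finally show ?thesis .
qed

text \<open>The distance to the circle is at least a fixed multiple of the distance measured in the direction
  of the larger coordinate, since the circle is crossed at a definite angle there. This
  allows Cartesian coordinates in place of polar ones.\<close>
lemma disc_weight_le:
  fixes x y \<alpha> :: real
  assumes "x\<^sup>2 + y\<^sup>2 < 1" "\<bar>y\<bar> \<le> \<bar>x\<bar>" "\<alpha> \<le> 0"
  shows "\<bar>x\<bar> < sqrt (1 - y\<^sup>2)"
    and "(1 - sqrt (x\<^sup>2 + y\<^sup>2)) powr \<alpha> \<le> 4 powr (-\<alpha>) * (sqrt (1 - y\<^sup>2) - \<bar>x\<bar>) powr \<alpha>"
proof -
  define X where "X = sqrt (1 - y\<^sup>2)"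
  define r where "r = sqrt (x\<^sup>2 + y\<^sup>2)"
  have r: "0 \<le> r" "r < 1" "r\<^sup>2 = x\<^sup>2 + y\<^sup>2" using assms by (auto simp: r_def)
  have yx: "y\<^sup>2 \<le> x\<^sup>2" using assms(2) by (simp add: abs_le_square_iff)
  have X2: "X\<^sup>2 = 1 - y\<^sup>2" using assms(1) by (simp add: X_def) (smt (verit) zero_le_power2)
  have "(1/2)\<^sup>2 \<le> X\<^sup>2" unfolding X2 using yx assms(1) by (simp add: power2_eq_square)
  then have X: "1/2 \<le> X" by (rule power2_le_imp_le) (use assms in \<open>auto simp: X_def\<close>, smt (verit) zero_le_power2)
  have "\<bar>x\<bar>\<^sup>2 < X\<^sup>2" using X2 assms(1) by simp
  then have xX: "\<bar>x\<bar> < X" by (rule power2_less_imp_less) (use X in simp)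
  then show "\<bar>x\<bar> < sqrt (1 - y\<^sup>2)" by (simp add: X_def)
  have "(X - \<bar>x\<bar>) * (1/2) \<le> (X - \<bar>x\<bar>) * (X + \<bar>x\<bar>)" using X xX by (intro mult_left_mono) auto
  also have "\<dots> = (1 - r) * (1 + r)" using X2 r(3) by (simp add: power2_eq_square algebra_simps)
  also have "\<dots> \<le> (1 - r) * 2" using r by (intro mult_left_mono) auto
  finally have "(X - \<bar>x\<bar>) / 4 \<le> 1 - r" by simp
  then have "(1 - r) powr \<alpha> \<le> ((X - \<bar>x\<bar>) / 4) powr \<alpha>" using xX assms(3) by (intro powr_mono2') auto
  also have "\<dots> = 4 powr (-\<alpha>) * (X - \<bar>x\<bar>) powr \<alpha>"
    using xX by (simp add: powr_divide powr_minus field_simps)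
  finally show "(1 - sqrt (x\<^sup>2 + y\<^sup>2)) powr \<alpha> \<le> 4 powr (-\<alpha>) * (sqrt (1 - y\<^sup>2) - \<bar>x\<bar>) powr \<alpha>"
    by (simp add: X_def r_def)
qed

text \<open>The kernel's denominator dominates both the distance of \<open>a\<close> to the circle and the distance of \<open>z\<close> to the radial
  projection of \<open>a\<close>.\<close>
lemma norm_one_minus_cnj_mult_ge:
  assumes "a \<noteq> 0" "norm a < 1" "norm z < 1"
  shows "(1 - norm a) + norm (z - a / of_real (norm a)) \<le> 3 * norm (1 - cnj a * z)"
proof -
  define u where "u = a / of_real (norm a)"
  have u: "norm u = 1" "u * cnj u = 1" "cnj a = of_real (norm a) * cnj u"
    using assms(1) complex_norm_square[of a] by (auto simp: u_def norm_divide power2_eq_square)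
  have "norm (cnj a * z) \<le> norm a" using assms by (simp add: norm_mult mult_left_le)
  with norm_triangle_ineq2[of 1 "cnj a * z"] have 1: "1 - norm a \<le> norm (1 - cnj a * z)" by simp
  have "norm (z - u) = norm (cnj u) * norm (u - z)" using u(1) by (simp add: norm_minus_commute)
  also have "\<dots> = norm (1 - cnj u * z)" unfolding norm_mult[symmetric] using u(2) by (simp add: algebra_simps)
  also have "1 - cnj u * z = (1 - cnj a * z) - of_real (1 - norm a) * (cnj u * z)"
    using u(3) by (simp add: algebra_simps)
  also have "norm \<dots> \<le> norm (1 - cnj a * z) + norm (of_real (1 - norm a) * (cnj u * z))" by (rule norm_triangle_ineq4)
  also have "norm (of_real (1 - norm a) * (cnj u * z)) \<le> 1 - norm a"
    using u(1) assms by (simp add: norm_mult mult_left_le del: of_real_diff)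
  finally show ?thesis using 1 by (simp add: u_def)
qed

text \<open>A Forelli--Rudin type estimate. The exponent \<open>2 * p\<close> is split as \<open>q1 + q2\<close> with \<open>q1 > 1 + \<alpha>\<close> and \<open>q2 > 1\<close>, which is
  possible exactly because \<open>2 * p > 2 + \<alpha>\<close>. By the two lower bounds for the denominator the integrand
  is then dominated by a product that can be integrated one coordinate at a time: \<open>q1\<close> is given to the coordinate
  along which the weight is integrated, \<open>q2\<close> to the other one.\<close>
lemma area_integral_szego_power:
  fixes \<alpha> p :: real
  assumes \<alpha>: "-1 < \<alpha>" "\<alpha> \<le> 0" and p: "1 + \<alpha> / 2 < p"
  obtains C where "C \<ge> 0" and
    "\<And>a. a \<noteq> 0 \<Longrightarrow> norm a < 1 \<Longrightarrow>
       (\<integral>\<^sup>+z\<in>unit_disc. ennreal (norm (1 - cnj a * z) powr (-2 * p) * (1 - norm z) powr \<alpha>) \<partial>lborel)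
         \<le> ennreal (C * (1 - norm a) powr (2 + \<alpha> - 2 * p))"
proof -
  \<comment> \<open>The slack in \<open>2 * p > 2 + \<alpha>\<close> is shared equally between the two exponents.\<close>
  define e where "e = (2 * p - 2 - \<alpha>) / 2"
  define q1 where "q1 = 1 + \<alpha> + e"
  define q2 where "q2 = 1 + e"
  have e: "e > 0" using p by (simp add: e_def)
  have q: "1 + \<alpha> < q1" "1 < q2" "q1 + q2 = 2 * p" "q1 > 0" using e \<alpha> by (auto simp: q1_def q2_def e_def field_simps)
  define C1 where "C1 = 2 * (1 / (1 + \<alpha>) + 1 / (q1 - 1 - \<alpha>))"
  define C2 where "C2 = 2 * (1 + 1 / (q2 - 1))"
  define K where "K = 4 powr (-\<alpha>) * 3 powr (2 * p)"
  have C: "C1 \<ge> 0" "C2 \<ge> 0" "K \<ge> 0" using q \<alpha> by (auto simp: C1_def C2_def K_def)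
  define W where "W X x = (if \<bar>x\<bar> < X then (X - \<bar>x\<bar>) powr \<alpha> else 0)" for X x :: real
  define T where "T d c1 c2 x y = W (sqrt (1 - y\<^sup>2)) x * (d + \<bar>x - c1\<bar>) powr (-q1) * (d + \<bar>y - c2\<bar>) powr (-q2)"
    for d c1 c2 x y :: real
  have W0: "W X x \<ge> 0" for X x by (simp add: W_def)
  have T0: "T d c1 c2 x y \<ge> 0" for d c1 c2 x y by (simp add: T_def W0)
  have Tm [measurable]: "(\<lambda>(x, y). T d c1 c2 x y) \<in> borel_measurable (lborel \<Otimes>\<^sub>M lborel)" for d c1 c2
    unfolding T_def W_def by measurable
  have T: "(\<integral>\<^sup>+y. \<integral>\<^sup>+x. ennreal (T d c1 c2 x y) \<partial>lborel \<partial>lborel) \<le> ennreal (3 * C1 * C2 * d powr (2 + \<alpha> - 2 * p))"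
    if d: "0 < d" for d c1 c2
  proof -
    have "(\<integral>\<^sup>+y. \<integral>\<^sup>+x. ennreal (T d c1 c2 x y) \<partial>lborel \<partial>lborel)
      \<le> (\<integral>\<^sup>+y. ennreal (3 * (C1 * d powr (1 + \<alpha> - q1))) * ennreal (\<bar>y - c2\<bar> powr 0 * (d + \<bar>y - c2\<bar>) powr (-q2)) \<partial>lborel)"
    proof (rule nn_integral_mono_AE)
      \<comment> \<open>The factor with exponent \<open>0\<close> equals one except at \<open>y = c2\<close>.\<close>
      have "AE y in lborel. y \<noteq> c2" by (rule AE_lborel_singleton)
      then show "AE y in lborel. (\<integral>\<^sup>+x. ennreal (T d c1 c2 x y) \<partial>lborel)
        \<le> ennreal (3 * (C1 * d powr (1 + \<alpha> - q1))) * ennreal (\<bar>y - c2\<bar> powr 0 * (d + \<bar>y - c2\<bar>) powr (-q2))"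
      proof eventually_elim
        case (elim y)
        have "(\<integral>\<^sup>+x. ennreal (T d c1 c2 x y) \<partial>lborel) =
          (\<integral>\<^sup>+x. ennreal (W (sqrt (1 - y\<^sup>2)) x * (d + \<bar>x - c1\<bar>) powr (-q1)) \<partial>lborel) * ennreal ((d + \<bar>y - c2\<bar>) powr (-q2))"
          unfolding T_def
          by (subst nn_integral_multc[symmetric]) (auto simp: W_def ennreal_mult[symmetric])
        also have "(\<integral>\<^sup>+x. ennreal (W (sqrt (1 - y\<^sup>2)) x * (d + \<bar>x - c1\<bar>) powr (-q1)) \<partial>lborel)
            \<le> ennreal (3 * (C1 * d powr (1 + \<alpha> - q1)))"
          using nn_integral_two_centres[OF \<alpha> q(1) d] unfolding W_def C1_def by simp
        finally show ?case using elim by (simp add: mult_right_mono)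
      qed
    qed
    also have "\<dots> = ennreal (3 * (C1 * d powr (1 + \<alpha> - q1))) * (\<integral>\<^sup>+y. ennreal (\<bar>y - c2\<bar> powr 0 * (d + \<bar>y - c2\<bar>) powr (-q2)) \<partial>lborel)"
      by (rule nn_integral_cmult) measurable
    also have "\<dots> \<le> ennreal (3 * (C1 * d powr (1 + \<alpha> - q1))) * ennreal (C2 * d powr (1 - q2))"
      using nn_integral_shifted_power[of 0 q2 d c2] q d by (intro mult_left_mono) (auto simp: C2_def)
    also have "\<dots> = ennreal (3 * C1 * C2 * (d powr (1 + \<alpha> - q1) * d powr (1 - q2)))"
      using C by (simp add: mult_ac flip: ennreal_mult)
    also have "d powr (1 + \<alpha> - q1) * d powr (1 - q2) = d powr (2 + \<alpha> - 2 * p)"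
      unfolding powr_add[symmetric] q(3)[symmetric] by (simp add: algebra_simps)
    finally show ?thesis .
  qed
  show ?thesis
  proof (rule that[of "K * (6 * C1 * C2)"])
    fix a :: complex assume a: "a \<noteq> 0" "norm a < 1"
    define d where "d = 1 - norm a"
    define u where "u = a / of_real (norm a)"
    have d: "0 < d" using a by (simp add: d_def)
    have pw: "norm (1 - cnj a * Complex x y) powr (-2 * p) * (1 - norm (Complex x y)) powr \<alpha>
        \<le> K * (T d (Re u) (Im u) x y + T d (Im u) (Re u) y x)" if z: "norm (Complex x y) < 1" for x y
    proof -
      let ?z = "Complex x y"
      have xy: "x\<^sup>2 + y\<^sup>2 < 1" using z by (simp add: cmod_def)
      have dz: "d + norm (?z - u) \<le> 3 * norm (1 - cnj a * ?z)"
        using norm_one_minus_cnj_mult_ge[OF a z] by (simp add: d_def u_def)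
      have dx: "(d + \<bar>x - Re u\<bar>) / 3 \<le> norm (1 - cnj a * ?z)" and dy: "(d + \<bar>y - Im u\<bar>) / 3 \<le> norm (1 - cnj a * ?z)"
        using dz abs_Re_le_cmod[of "?z - u"] abs_Im_le_cmod[of "?z - u"] by auto
      have third: "norm (1 - cnj a * ?z) powr (-q) \<le> 3 powr q * (d + \<bar>s\<bar>) powr (-q)"
        if "(d + \<bar>s\<bar>) / 3 \<le> norm (1 - cnj a * ?z)" "q > 0" for s q
      proof -
        have "norm (1 - cnj a * ?z) powr (-q) \<le> ((d + \<bar>s\<bar>) / 3) powr (-q)"
          using that d by (intro powr_mono2') auto
        also have "\<dots> = 3 powr q * (d + \<bar>s\<bar>) powr (-q)" using d by (simp add: powr_divide powr_minus field_simps)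
        finally show ?thesis .
      qed
      have combine: "norm (1 - cnj a * ?z) powr (-2 * p) \<le> 3 powr (2 * p) * ((d + \<bar>s\<bar>) powr (-q1) * (d + \<bar>t\<bar>) powr (-q2))"
        if "(d + \<bar>s\<bar>) / 3 \<le> norm (1 - cnj a * ?z)" "(d + \<bar>t\<bar>) / 3 \<le> norm (1 - cnj a * ?z)" for s t
      proof -
        have "norm (1 - cnj a * ?z) powr (-2 * p) = norm (1 - cnj a * ?z) powr (-q1) * norm (1 - cnj a * ?z) powr (-q2)"
        proof -
          have "-2 * p = -q1 + -q2" using q(3) by simp
          then show ?thesis by (simp only: powr_add)
        qed
        also have "\<dots> \<le> (3 powr q1 * (d + \<bar>s\<bar>) powr (-q1)) * (3 powr q2 * (d + \<bar>t\<bar>) powr (-q2))"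
          using that q by (intro mult_mono third) auto
        also have "\<dots> = 3 powr (q1 + q2) * ((d + \<bar>s\<bar>) powr (-q1) * (d + \<bar>t\<bar>) powr (-q2))"
          by (simp add: powr_add mult_ac)
        finally show ?thesis by (simp only: q(3))
      qed
      show ?thesis
      proof (cases "\<bar>y\<bar> \<le> \<bar>x\<bar>")
        case True
        note w = disc_weight_le[OF xy True \<alpha>(2)]
        have "norm (1 - cnj a * ?z) powr (-2 * p) * (1 - norm ?z) powr \<alpha> \<le>
          (3 powr (2 * p) * ((d + \<bar>x - Re u\<bar>) powr (-q1) * (d + \<bar>y - Im u\<bar>) powr (-q2))) *
          (4 powr (-\<alpha>) * W (sqrt (1 - y\<^sup>2)) x)"
          using w by (intro mult_mono combine dx dy) (auto simp: W_def cmod_def)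
        also have "\<dots> = K * T d (Re u) (Im u) x y" by (simp add: K_def T_def mult_ac)
        finally show ?thesis using T0 C by (simp add: ring_distribs add_increasing2)
      next
        case False
        then have w: "\<bar>y\<bar> < sqrt (1 - x\<^sup>2)" "(1 - sqrt (x\<^sup>2 + y\<^sup>2)) powr \<alpha> \<le> 4 powr (-\<alpha>) * (sqrt (1 - x\<^sup>2) - \<bar>y\<bar>) powr \<alpha>"
          using disc_weight_le[of y x \<alpha>] xy \<alpha> by (auto simp: add.commute)
        have "norm (1 - cnj a * ?z) powr (-2 * p) * (1 - norm ?z) powr \<alpha> \<le>
          (3 powr (2 * p) * ((d + \<bar>y - Im u\<bar>) powr (-q1) * (d + \<bar>x - Re u\<bar>) powr (-q2))) *
          (4 powr (-\<alpha>) * W (sqrt (1 - x\<^sup>2)) y)"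
          using w by (intro mult_mono combine dx dy) (auto simp: W_def cmod_def)
        also have "\<dots> = K * T d (Im u) (Re u) y x" by (simp add: K_def T_def mult_ac)
        finally show ?thesis using T0 C by (simp add: ring_distribs add_increasing)
      qed
    qed
    let ?D = "3 * C1 * C2 * d powr (2 + \<alpha> - 2 * p)"
    have "(\<integral>\<^sup>+z\<in>unit_disc. ennreal (norm (1 - cnj a * z) powr (-2 * p) * (1 - norm z) powr \<alpha>) \<partial>lborel)
      = (\<integral>\<^sup>+x. \<integral>\<^sup>+y. ennreal (norm (1 - cnj a * Complex x y) powr (-2 * p) * (1 - norm (Complex x y)) powr \<alpha>)
          * indicator unit_disc (Complex x y) \<partial>lborel \<partial>lborel)"
      by (rule nn_integral_complex) (auto intro!: borel_measurable_times_ennreal borel_measurable_indicator)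
    also have "\<dots> \<le> (\<integral>\<^sup>+x. \<integral>\<^sup>+y. ennreal K * (ennreal (T d (Re u) (Im u) x y) + ennreal (T d (Im u) (Re u) y x)) \<partial>lborel \<partial>lborel)"
      using pw C T0 by (intro nn_integral_mono)
        (auto simp: indicator_def simp flip: ennreal_plus ennreal_mult intro!: ennreal_leI)
    also have "\<dots> = ennreal K * ((\<integral>\<^sup>+x. \<integral>\<^sup>+y. ennreal (T d (Re u) (Im u) x y) \<partial>lborel \<partial>lborel)
        + (\<integral>\<^sup>+x. \<integral>\<^sup>+y. ennreal (T d (Im u) (Re u) y x) \<partial>lborel \<partial>lborel))"
      by (simp add: nn_integral_cmult nn_integral_add)
    also have "(\<integral>\<^sup>+x. \<integral>\<^sup>+y. ennreal (T d (Re u) (Im u) x y) \<partial>lborel \<partial>lborel) =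
        (\<integral>\<^sup>+y. \<integral>\<^sup>+x. ennreal (T d (Re u) (Im u) x y) \<partial>lborel \<partial>lborel)"
      by (rule lborel_pair.Fubini'[symmetric]) measurable
    also have "ennreal K * ((\<integral>\<^sup>+y. \<integral>\<^sup>+x. ennreal (T d (Re u) (Im u) x y) \<partial>lborel \<partial>lborel)
        + (\<integral>\<^sup>+x. \<integral>\<^sup>+y. ennreal (T d (Im u) (Re u) y x) \<partial>lborel \<partial>lborel)) \<le> ennreal K * (ennreal ?D + ennreal ?D)"
      by (intro mult_left_mono add_mono T d) auto
    also have "\<dots> = ennreal (K * (6 * C1 * C2) * (1 - norm a) powr (2 + \<alpha> - 2 * p))"
      using C by (simp add: d_def mult_ac flip: ennreal_plus ennreal_mult)
    finally show "(\<integral>\<^sup>+z\<in>unit_disc. ennreal (norm (1 - cnj a * z) powr (-2 * p) * (1 - norm z) powr \<alpha>) \<partial>lborel)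
      \<le> ennreal (K * (6 * C1 * C2) * (1 - norm a) powr (2 + \<alpha> - 2 * p))" .
  qed (use C in auto)
qed

section \<open>Membership of the derivative in the Bergman space\<close>

lemma powr_sum_le_sum_powr:
  fixes x :: "'a \<Rightarrow> real"
  assumes "\<And>i. i \<in> I \<Longrightarrow> 0 \<le> x i" "0 < p" "p \<le> 1"
  shows "(\<Sum>i\<in>I. x i) powr p \<le> (\<Sum>i\<in>I. x i powr p)"
proof -
  define s where "s = (\<Sum>i\<in>I. x i)"
  show ?thesis
  proof (cases "finite I \<and> s > 0")
    case True
    have "1 = (\<Sum>i\<in>I. x i / s)" using True by (simp add: s_def flip: sum_divide_distrib)
    also have "\<dots> \<le> (\<Sum>i\<in>I. (x i / s) powr p)"
    proof (rule sum_mono)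
      fix i assume i: "i \<in> I"
      have "x i \<le> s" unfolding s_def using True i assms by (intro member_le_sum) auto
      then have "0 \<le> x i / s" "x i / s \<le> 1" using True assms(1)[OF i] by auto
      then show "x i / s \<le> (x i / s) powr p"
        using powr_mono'[of p 1 "x i / s"] assms(3) by (simp only: powr_one)
    qed
    also have "\<dots> = (\<Sum>i\<in>I. x i powr p) / s powr p"
      using True assms(1) by (simp add: powr_divide sum_divide_distrib)
    finally show ?thesis using True by (simp add: s_def field_simps)
  next
    case False
    then have "s = 0" using assms(1) sum_nonneg[of I x] by (auto simp: s_def)
    then show ?thesis using assms by (simp add: s_def sum_nonneg)
  qed
qed

text \<open>A form of Young's inequality with non-optimal constants: whichever of \<open>c powr (2 - p)\<close> and \<open>x\<close> is larger
  dominates the product.\<close>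
lemma young_powr:
  fixes c x p :: real
  assumes "c \<ge> 0" "x \<ge> 0" "0 < p" "p < 2"
  shows "c powr p * x \<le> c\<^sup>2 + x powr (2 / (2 - p))"
proof (cases "x \<le> c powr (2 - p)")
  case True
  then have "c powr p * x \<le> c powr p * c powr (2 - p)" by (intro mult_left_mono) auto
  also have "\<dots> = c\<^sup>2" using assms by (cases "c = 0") (auto simp flip: powr_add)
  finally show ?thesis by (rule add_increasing2[OF powr_ge_zero])
next
  case False
  then have x: "x > 0" using assms by (smt (verit) powr_ge_zero)
  have "c = (c powr (2 - p)) powr (1 / (2 - p))" using assms by (simp add: powr_powr)
  also have "\<dots> \<le> x powr (1 / (2 - p))" using False assms by (intro powr_mono2) auto
  finally have "c powr p \<le> (x powr (1 / (2 - p))) powr p" using assms by (intro powr_mono2) auto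
  then have "c powr p * x \<le> (x powr (1 / (2 - p))) powr p * x powr 1" using x by (intro mult_mono) auto
  also have "\<dots> = x powr (p / (2 - p) + 1)" by (simp only: powr_powr powr_add) simp
  also have "p / (2 - p) + 1 = 2 / (2 - p)" using assms by (simp add: field_simps)
  finally show ?thesis by (rule add_increasing[OF zero_le_power2])
qed

lemma szego_has_field_derivative:
  assumes "norm a < 1" "norm z < 1"
  shows "(szego a has_field_derivative cnj a / (1 - cnj a * z)\<^sup>2) (at z)"
proof -
  have "1 - cnj a * z \<noteq> 0" using one_minus_cnj_mult_bound(2)[of a z] assms by auto
  then show ?thesis unfolding szego_def[abs_def]
    by (auto intro!: derivative_eq_intros simp: power2_eq_square)
qed

text \<open>For \<open>p \<le> 1\<close> the \<open>p\<close>-th power of a sum is at most the sum of the \<open>p\<close>-th powers, so that the kernels can be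
  integrated separately.\<close>
lemma bergman_integral_kernel_sum_le:
  assumes p: "0 < p" "p \<le> 1"
    and a: "\<And>k. k < N \<Longrightarrow> norm (a k) < 1"
    and C: "C \<ge> 0" "\<And>k. k < N \<Longrightarrow>
       (\<integral>\<^sup>+z\<in>unit_disc. ennreal (norm (1 - cnj (a k) * z) powr (-2 * p) * (1 - norm z) powr \<alpha>) \<partial>lborel)
         \<le> ennreal (C * (1 - norm (a k)) powr s)"
  shows "(\<integral>\<^sup>+z\<in>unit_disc. ennreal (norm (\<Sum>k<N. \<gamma> k * (cnj (a k) / (1 - cnj (a k) * z)\<^sup>2)) powr p * (1 - norm z) powr \<alpha>) \<partial>lborel)
    \<le> ennreal (C * (\<Sum>k<N. norm (\<gamma> k) powr p * (1 - norm (a k)) powr s))"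
proof -
  define I where "I k z = norm (1 - cnj (a k) * z) powr (-2 * p) * (1 - norm z) powr \<alpha>" for k z
  have [measurable]: "I k \<in> borel_measurable borel" for k unfolding I_def[abs_def] by measurable
  have [measurable]: "unit_disc \<in> sets (borel :: complex measure)" by simp
  have pw: "norm (\<Sum>k<N. \<gamma> k * (cnj (a k) / (1 - cnj (a k) * z)\<^sup>2)) powr p * (1 - norm z) powr \<alpha>
      \<le> (\<Sum>k<N. norm (\<gamma> k) powr p * I k z)" if z: "norm z < 1" for z
  proof -
    have "norm (\<Sum>k<N. \<gamma> k * (cnj (a k) / (1 - cnj (a k) * z)\<^sup>2)) powr p
      \<le> (\<Sum>k<N. norm (\<gamma> k * (cnj (a k) / (1 - cnj (a k) * z)\<^sup>2))) powr p"
      using p by (intro powr_mono2 norm_sum) auto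
    also have "\<dots> \<le> (\<Sum>k<N. norm (\<gamma> k * (cnj (a k) / (1 - cnj (a k) * z)\<^sup>2)) powr p)"
      using p by (intro powr_sum_le_sum_powr) auto
    also have "\<dots> \<le> (\<Sum>k<N. norm (\<gamma> k) powr p * norm (1 - cnj (a k) * z) powr (-2 * p))"
    proof (rule sum_mono)
      fix k assume k: "k \<in> {..<N}"
      define x where "x = norm (1 - cnj (a k) * z)"
      have x: "x > 0" using one_minus_cnj_mult_bound(2)[of "a k" z] a[of k] k z by (simp add: x_def)
      have "norm (\<gamma> k * (cnj (a k) / (1 - cnj (a k) * z)\<^sup>2)) = norm (\<gamma> k) * (norm (a k) * (1 / x\<^sup>2))"
        by (simp add: norm_mult norm_divide norm_power x_def)
      also have "\<dots> \<le> norm (\<gamma> k) * (1 * (1 / x\<^sup>2))"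
        using a[of k] k by (intro mult_left_mono mult_right_mono) auto
      finally have "norm (\<gamma> k * (cnj (a k) / (1 - cnj (a k) * z)\<^sup>2)) powr p \<le> (norm (\<gamma> k) * (1 / x\<^sup>2)) powr p"
        using p by (intro powr_mono2) auto
      also have "\<dots> = norm (\<gamma> k) powr p * (x powr (-2)) powr p"
        using x by (subst powr_mult) (simp_all add: powr_minus_divide powr_numeral)
      also have "(x powr (-2)) powr p = x powr (-2 * p)" by (simp only: powr_powr)
      finally show "norm (\<gamma> k * (cnj (a k) / (1 - cnj (a k) * z)\<^sup>2)) powr p \<le> norm (\<gamma> k) powr p * norm (1 - cnj (a k) * z) powr (-2 * p)"
        unfolding x_def .
    qed
    finally have "norm (\<Sum>k<N. \<gamma> k * (cnj (a k) / (1 - cnj (a k) * z)\<^sup>2)) powr p * (1 - norm z) powr \<alpha>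
      \<le> (\<Sum>k<N. norm (\<gamma> k) powr p * norm (1 - cnj (a k) * z) powr (-2 * p)) * (1 - norm z) powr \<alpha>"
      by (rule mult_right_mono) simp
    also have "\<dots> = (\<Sum>k<N. norm (\<gamma> k) powr p * I k z)"
      by (simp only: I_def sum_distrib_right mult.assoc)
    finally show ?thesis .
  qed
  have I0: "I k z \<ge> 0" for k z by (simp add: I_def)
  have "(\<integral>\<^sup>+z\<in>unit_disc. ennreal (norm (\<Sum>k<N. \<gamma> k * (cnj (a k) / (1 - cnj (a k) * z)\<^sup>2)) powr p * (1 - norm z) powr \<alpha>) \<partial>lborel)
    \<le> (\<integral>\<^sup>+z. (\<Sum>k<N. ennreal (norm (\<gamma> k) powr p) * (ennreal (I k z) * indicator unit_disc z)) \<partial>lborel)"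
  proof (rule nn_integral_mono)
    fix z :: complex
    have "(\<Sum>k<N. ennreal (norm (\<gamma> k) powr p) * ennreal (I k z)) = ennreal (\<Sum>k<N. norm (\<gamma> k) powr p * I k z)"
      by (simp add: I0 ennreal_mult flip: sum_ennreal)
    then show "ennreal (norm (\<Sum>k<N. \<gamma> k * (cnj (a k) / (1 - cnj (a k) * z)\<^sup>2)) powr p * (1 - norm z) powr \<alpha>) * indicator unit_disc z
      \<le> (\<Sum>k<N. ennreal (norm (\<gamma> k) powr p) * (ennreal (I k z) * indicator unit_disc z))"
      using pw[of z] by (cases "norm z < 1") (auto intro!: ennreal_leI)
  qed
  also have "\<dots> = (\<Sum>k<N. ennreal (norm (\<gamma> k) powr p) * (\<integral>\<^sup>+z. ennreal (I k z) * indicator unit_disc z \<partial>lborel))"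
    by (subst nn_integral_sum) (auto intro!: sum.cong nn_integral_cmult)
  also have "\<dots> \<le> (\<Sum>k<N. ennreal (norm (\<gamma> k) powr p) * ennreal (C * (1 - norm (a k)) powr s))"
    using C(2) unfolding I_def by (intro sum_mono mult_left_mono) auto
  also have "\<dots> = ennreal (C * (\<Sum>k<N. norm (\<gamma> k) powr p * (1 - norm (a k)) powr s))"
    using C(1) by (simp add: sum_distrib_left mult_ac flip: ennreal_mult)
  finally show ?thesis .
qed

text \<open>Young's inequality with the conjugate exponents \<open>2 / p\<close> and \<open>2 / (2 - p)\<close>, applied to the normalized coefficients
  \<open>c\<close>, separates them from a power of \<open>d = 1 - norm (a k)\<close>. Normalization moves \<open>d powr (p / 2)\<close> to the other
  factor, and raising \<open>d powr (2 + \<alpha> - 3 * p / 2)\<close> to the power \<open>2 / (2 - p)\<close> gives the exponent of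
  the summability condition.\<close>
lemma coefficient_sum_le:
  fixes \<gamma> :: "nat \<Rightarrow> complex"
  assumes p: "0 < p" "p < 2" and a: "\<And>k. norm (a k) < 1"
    and M: "(\<Sum>k<N. (norm (\<gamma> k))\<^sup>2 / (1 - (norm (a k))\<^sup>2)) \<le> M"
    and S: "summable (\<lambda>n. (1 - norm (a n)) powr ((4 - 3 * p + 2 * \<alpha>) / (2 - p)))"
  shows "(\<Sum>k<N. norm (\<gamma> k) powr p * (1 - norm (a k)) powr (2 + \<alpha> - 2 * p))
    \<le> 2 * M + (\<Sum>n. (1 - norm (a n)) powr ((4 - 3 * p + 2 * \<alpha>) / (2 - p)))"
proof -
  let ?g = "(4 - 3 * p + 2 * \<alpha>) / (2 - p)"
  have "(\<Sum>k<N. norm (\<gamma> k) powr p * (1 - norm (a k)) powr (2 + \<alpha> - 2 * p))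
      \<le> (\<Sum>k<N. 2 * ((norm (\<gamma> k))\<^sup>2 / (1 - (norm (a k))\<^sup>2)) + (1 - norm (a k)) powr ?g)"
  proof (rule sum_mono)
    fix k
    define d where "d = 1 - norm (a k)"
    have d: "0 < d" "d \<le> 1" using a[of k] by (auto simp: d_def)
    define c where "c = norm (\<gamma> k) / d powr (1/2)"
    have "norm (\<gamma> k) = c * d powr (1/2)" using d by (simp add: c_def)
    then have "norm (\<gamma> k) powr p = c powr p * (d powr (1/2)) powr p"
      using d by (simp only: powr_mult)
    then have "norm (\<gamma> k) powr p * d powr (2 + \<alpha> - 2 * p) = c powr p * (d powr (p / 2) * d powr (2 + \<alpha> - 2 * p))"
      by (simp add: powr_powr)
    also have "d powr (p / 2) * d powr (2 + \<alpha> - 2 * p) = d powr (2 + \<alpha> - 3 * p / 2)"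
      by (simp flip: powr_add)
    also have "c powr p * d powr (2 + \<alpha> - 3 * p / 2) \<le> c\<^sup>2 + (d powr (2 + \<alpha> - 3 * p / 2)) powr (2 / (2 - p))"
      using p by (intro young_powr) (auto simp: c_def)
    also have "(d powr (2 + \<alpha> - 3 * p / 2)) powr (2 / (2 - p)) = d powr ?g"
    proof -
      have "(2 + \<alpha> - 3 * p / 2) * (2 / (2 - p)) = ?g" using p by (simp add: field_simps)
      then show ?thesis by (simp only: powr_powr)
    qed
    also have "c\<^sup>2 \<le> 2 * ((norm (\<gamma> k))\<^sup>2 / (1 - (norm (a k))\<^sup>2))"
    proof -
      have "c\<^sup>2 = (norm (\<gamma> k))\<^sup>2 / d"
        using d by (simp add: c_def power_divide powr_half_sqrt)
      also have "\<dots> \<le> (norm (\<gamma> k))\<^sup>2 / ((1 - (norm (a k))\<^sup>2) / 2)"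
      proof (rule divide_left_mono)
        have e: "1 - (norm (a k))\<^sup>2 = d * (1 + norm (a k))" by (simp add: d_def power2_eq_square algebra_simps)
        show "(1 - (norm (a k))\<^sup>2) / 2 \<le> d" unfolding e using d a[of k] mult_left_mono[of "1 + norm (a k)" 2 d] by simp
        show "0 < d * ((1 - (norm (a k))\<^sup>2) / 2)" unfolding e using d
          by (intro mult_pos_pos divide_pos_pos) (auto simp: add_pos_nonneg)
      qed simp
      finally show ?thesis by (simp add: mult.commute)
    qed
    finally show "norm (\<gamma> k) powr p * (1 - norm (a k)) powr (2 + \<alpha> - 2 * p)
      \<le> 2 * ((norm (\<gamma> k))\<^sup>2 / (1 - (norm (a k))\<^sup>2)) + (1 - norm (a k)) powr ?g" by (simp add: d_def)
  qed
  also have "\<dots> = 2 * (\<Sum>k<N. (norm (\<gamma> k))\<^sup>2 / (1 - (norm (a k))\<^sup>2)) + (\<Sum>k<N. (1 - norm (a k)) powr ?g)"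
    by (simp only: sum.distrib sum_distrib_left)
  also have "\<dots> \<le> 2 * M + (\<Sum>n. (1 - norm (a n)) powr ?g)"
    using M sum_le_suminf[OF S, of "{..<N}"] by simp
  finally show ?thesis .
qed

text \<open>Fatou's lemma turns uniform bounds for pointwise approximants into membership of the limit.\<close>
lemma bergman_space_limit:
  assumes p: "p > 0" and f: "f holomorphic_on unit_disc"
    and D: "\<And>N. D N \<in> borel_measurable borel"
    and lim: "\<And>z. norm z < 1 \<Longrightarrow> (\<lambda>N. D N z) \<longlonglongrightarrow> f z"
    and M: "\<And>N. (\<integral>\<^sup>+z\<in>unit_disc. ennreal (norm (D N z) powr p * (1 - norm z) powr \<alpha>) \<partial>lborel) \<le> ennreal M"
  shows "f \<in> bergman_space p \<alpha>"
proof -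
  note [measurable] = D
  have [measurable]: "unit_disc \<in> sets (borel :: complex measure)" by simp
  define I where "I N z = ennreal (norm (D N z) powr p * (1 - norm z) powr \<alpha>) * indicator unit_disc z" for N z
  have I: "I N \<in> borel_measurable lborel" for N unfolding I_def[abs_def] by measurable
  have "(\<integral>\<^sup>+z\<in>unit_disc. ennreal (norm (f z) powr p * (1 - norm z) powr \<alpha>) \<partial>lborel)
    = (\<integral>\<^sup>+z. liminf (\<lambda>N. I N z) \<partial>lborel)"
  proof (rule nn_integral_cong)
    fix z :: complex
    have "(\<lambda>N. I N z) \<longlonglongrightarrow> ennreal (norm (f z) powr p * (1 - norm z) powr \<alpha>) * indicator unit_disc z"
    proof (cases "norm z < 1")
      case True
      have "(\<lambda>N. norm (D N z) powr p * (1 - norm z) powr \<alpha>) \<longlonglongrightarrow> norm (f z) powr p * (1 - norm z) powr \<alpha>"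
        using p by (intro tendsto_mult tendsto_powr' tendsto_norm lim[OF True] tendsto_const) auto
      then show ?thesis using True by (simp add: I_def tendsto_ennrealI)
    qed (simp add: I_def)
    then show "ennreal (norm (f z) powr p * (1 - norm z) powr \<alpha>) * indicator unit_disc z = liminf (\<lambda>N. I N z)"
      by (rule lim_imp_Liminf[OF sequentially_bot, symmetric])
  qed
  also have "\<dots> \<le> liminf (\<lambda>N. \<integral>\<^sup>+z. I N z \<partial>lborel)" by (rule nn_integral_liminf[OF I])
  also have "\<dots> \<le> liminf (\<lambda>N::nat. ennreal M)"
    by (rule Liminf_mono) (use M in \<open>simp add: I_def\<close>)
  also have "\<dots> = ennreal M" by (rule Liminf_const) simp
  also have "\<dots> < \<infinity>" by simp
  finally show ?thesis using f by (simp add: bergman_space_def)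
qed

theorem theorem9:
  fixes a :: "nat \<Rightarrow> complex" and p \<alpha> :: real
  assumes "blaschke_sequence a"
    and "uniformly_separated a"
    and "-1 < \<alpha>" and "\<alpha> \<le> 0"
    and "1 + \<alpha> / 2 < p" and "p < min 1 (4 / 3 + 2 / 3 * \<alpha>)"
    and "summable (\<lambda>n. (1 - norm (a n)) powr ((4 - 3 * p + 2 * \<alpha>) / (2 - p)))"
  shows "\<forall>f \<in> model_space (blaschke_product a). deriv f \<in> bergman_space p \<alpha>"
proof
  fix f assume fm: "f \<in> model_space (blaschke_product a)"
  then have fH: "f \<in> hardy2" by (simp add: model_space_def hardy2_orth_def)
  note holf = hardy2_holomorphic[OF fH]
  have p: "0 < p" "p \<le> 1" "p < 2" using assms by auto
  note aD = blaschke_sequenceD[OF assms(1)]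
  obtain \<delta> where \<delta>: "\<delta> > 0" "inj a" "\<And>N n. \<delta> \<le> (\<Prod>m\<in>{..<N} - {n}. pseudohyperbolic (a m) (a n))"
    using uniformly_separated_finite_products[OF assms(1,2)] by blast
  obtain \<gamma> :: "nat \<Rightarrow> nat \<Rightarrow> complex" and \<epsilon> :: "nat \<Rightarrow> real" where
    interp: "\<And>N n. n < N \<Longrightarrow> (\<Sum>k<N. \<gamma> N k * szego (a k) (a n)) = f (a n)"
    and err: "\<And>N z. norm z < 1 \<Longrightarrow> norm (f z - (\<Sum>k<N. \<gamma> N k * szego (a k) z)) \<le> \<epsilon> N / (1 - norm z)"
    and \<epsilon>: "\<epsilon> \<longlonglongrightarrow> 0"
    using model_space_approximation[OF assms(1) \<delta>(2) fm] by blast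
  define F where "F N z = (\<Sum>k<N. \<gamma> N k * szego (a k) z)" for N z
  \<comment> \<open>The derivative of \<open>F N\<close> in the disc, as a formula that is measurable on the whole plane.\<close>
  define D where "D N z = (\<Sum>k<N. \<gamma> N k * (cnj (a k) / (1 - cnj (a k) * z)\<^sup>2))" for N z
  have deriv_F: "(F N has_field_derivative D N z) (at z)" if "z \<in> unit_disc" for N z
    unfolding F_def[abs_def] D_def using that aD(2)
    by (intro DERIV_sum DERIV_cmult szego_has_field_derivative) auto
  have "\<exists>g'. \<forall>z\<in>unit_disc. (f has_field_derivative g' z) (at z) \<and> (\<lambda>N. D N z) \<longlonglongrightarrow> g' z"
  proof (rule has_complex_derivative_uniform_sequence[OF open_ball deriv_F])
    fix x :: complex assume x: "x \<in> unit_disc"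
    define \<rho> where "\<rho> = (1 + norm x) / 2"
    have \<rho>: "\<rho> < 1" using x by (simp add: \<rho>_def)
    have sub: "cball x ((1 - norm x) / 2) \<subseteq> cball 0 \<rho>"
      by (simp add: \<rho>_def cball_subset_cball_iff field_simps)
    have "uniform_limit (cball x ((1 - norm x) / 2)) F f sequentially"
    proof (rule uniform_limitI)
      fix e :: real assume e: "e > 0"
      have "eventually (\<lambda>N. norm (\<epsilon> N) < e * (1 - \<rho>)) sequentially"
        using tendstoD[OF \<epsilon>, of "e * (1 - \<rho>)"] e \<rho> by simp
      then show "\<forall>\<^sub>F N in sequentially. \<forall>z\<in>cball x ((1 - norm x) / 2). dist (F N z) (f z) < e"
      proof eventually_elim
        case (elim N)
        show ?case
        proof
          fix z assume "z \<in> cball x ((1 - norm x) / 2)"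
          then have z: "norm z \<le> \<rho>" using sub by auto
          have "dist (F N z) (f z) \<le> \<epsilon> N / (1 - norm z)"
            using err[of z N] z \<rho> by (simp add: F_def dist_norm norm_minus_commute)
          also have "\<dots> \<le> norm (\<epsilon> N) / (1 - \<rho>)"
            using z \<rho> by (intro frac_le) auto
          also have "\<dots> < e" using elim \<rho> by (simp add: field_simps)
          finally show "dist (F N z) (f z) < e" .
        qed
      qed
    qed
    moreover have "cball x ((1 - norm x) / 2) \<subseteq> unit_disc" using sub \<rho> by force
    ultimately show "\<exists>d>0. cball x d \<subseteq> unit_disc \<and> uniform_limit (cball x d) F f sequentially"
      using x by (intro exI[of _ "(1 - norm x) / 2"]) auto
  qed
  then have lim: "(\<lambda>N. D N z) \<longlonglongrightarrow> deriv f z" if "norm z < 1" for z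
    using that by (metis DERIV_imp_deriv mem_ball_0)
  obtain C where C: "C \<ge> 0" "\<And>b. b \<noteq> 0 \<Longrightarrow> norm b < 1 \<Longrightarrow>
       (\<integral>\<^sup>+z\<in>unit_disc. ennreal (norm (1 - cnj b * z) powr (-2 * p) * (1 - norm z) powr \<alpha>) \<partial>lborel)
         \<le> ennreal (C * (1 - norm b) powr (2 + \<alpha> - 2 * p))"
    using area_integral_szego_power[OF assms(3,4,5)] by blast
  define M where "M = (exp 2 / \<delta> ^ 5)\<^sup>2 * energy f"
  have M: "(\<Sum>k<N. (norm (\<gamma> N k))\<^sup>2 / (1 - (norm (a k))\<^sup>2)) \<le> M" for N
  proof -
    have "(\<Sum>k<N. (norm (\<gamma> N k))\<^sup>2 / (1 - (norm (a k))\<^sup>2))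
        \<le> (exp 2 / \<delta> ^ 5)\<^sup>2 * energy (\<lambda>z. \<Sum>k<N. \<gamma> N k * szego (a k) z)"
      by (rule kernel_coefficients_le[OF assms(1) \<delta>(2,1,3)])
    also have "\<dots> \<le> M" unfolding M_def
      by (intro mult_left_mono energy_kernel_sum_le aD fH interp) auto
    finally show ?thesis .
  qed
  define L where "L = 2 * M + (\<Sum>n. (1 - norm (a n)) powr ((4 - 3 * p + 2 * \<alpha>) / (2 - p)))"
  show "deriv f \<in> bergman_space p \<alpha>"
  proof (rule bergman_space_limit[OF p(1) _ _ lim])
    show "deriv f holomorphic_on unit_disc" by (intro holomorphic_deriv holf open_ball)
    show "D N \<in> borel_measurable borel" for N unfolding D_def[abs_def] by measurable
    fix N
    have "(\<integral>\<^sup>+z\<in>unit_disc. ennreal (norm (D N z) powr p * (1 - norm z) powr \<alpha>) \<partial>lborel)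
      \<le> ennreal (C * (\<Sum>k<N. norm (\<gamma> N k) powr p * (1 - norm (a k)) powr (2 + \<alpha> - 2 * p)))"
      unfolding D_def by (intro bergman_integral_kernel_sum_le p C aD)
    also have "\<dots> \<le> ennreal (C * L)" unfolding L_def
      by (intro ennreal_leI mult_left_mono coefficient_sum_le p aD M assms(7) C)
    finally show "(\<integral>\<^sup>+z\<in>unit_disc. ennreal (norm (D N z) powr p * (1 - norm z) powr \<alpha>) \<partial>lborel) \<le> ennreal (C * L)" .
  qed
qed

end
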